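(* Let $\Lambda$ be a finite-dimensional basic algebra over a field $k$ with Jacobson radical $J$ satisfying $J^n=0$, let $e_i,e_j$ be primitive idempotents with $V_{ij}=e_jJ^{n-1}e_i\ne 0$, let $\ell_{ij}=\dim_{D_j}V_{ij}$ and $1\le s\le \ell_{ij}$. The rank-$s$ terminal completion is unique up to isomorphism (that is, all the modules $M_U$ with $U\in\operatorname{Gr}_{D_j}(\ell_{ij}-s,V_{ij})$ are isomorphic to each other) if and only if $D_i^\times$ acts transitively on $\operatorname{Gr}_{D_j}(\ell_{ij}-s,V_{ij})$ by right multiplication. Equivalently, failure of transitivity is equivalent to the existence of nonisomorphic rank-$s$ terminal completions $M_U\not\cong M_{U'}$ having the same complete tower of proper radical truncations $M/J^dM$, $1\le d<n$.
   Context: Modules are finite-dimensional left $\Lambda$-modules, $n\ge 1$, and $J^0=\Lambda$. Fix a complete set $e_1,\dots,e_t$ of primitive orthogonal idempotents of $\Lambda$, with $e_i,e_j$ among them; $\Lambda$ basic means the modules $\Lambda e_h$ are pairwise non-isomorphic. Put $P_i=\Lambda e_i$ and $D_h=e_h\Lambda e_h/e_hJe_h$, a division algebra; $V_{ij}=e_jJ^{n-1}e_i$ is a $(D_j,D_i)$-bimodule via left and right multiplication. $\operatorname{Gr}_{D_j}(\ell_{ij}-s,V_{ij})$ is the set of left $D_j$-submodules $U\subseteq V_{ij}$ with $\dim_{D_j}(V_{ij}/U)=s$. Put $W_j=\bigoplus_{h\ne j}e_hJ^{n-1}P_i$, and for such $U$ put $K_U=W_j\oplus U\subseteq J^{n-1}P_i$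 (a $\Lambda$-submodule of $P_i$) and $M_U=P_i/K_U$; the modules $M_U$ are the rank-$s$ terminal completions. *)

theory Defs
  imports "HOL-Algebra.Module" "HOL-Algebra.QuotRing" "HOL-Algebra.Ideal_Product"
    "HOL-Algebra.Generated_Groups"
begin

text \<open>
  Modules are values of the record type \<open>module\<close> of HOL-Algebra, of which only \<open>carrier\<close>, \<open>zero\<close>,
  \<open>add\<close> and \<open>smult\<close> matter. The locale \<open>module\<close> asks for a commutative ring of scalars, so it is
  used for the base field only; \<open>submodule\<close> carries no such restriction.
\<close>

definition mk_module :: "'b set \<Rightarrow> 'b \<Rightarrow> ('b \<Rightarrow> 'b \<Rightarrow> 'b) \<Rightarrow> ('a \<Rightarrow> 'b \<Rightarrow> 'b) \<Rightarrow> ('a, 'b) module" where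
  "mk_module C z a s =
     \<lparr>carrier = C, mult = undefined, one = undefined, zero = z, add = a, smult = s\<rparr>"

definition regular_module :: "('a, 'm) ring_scheme \<Rightarrow> ('a, 'a) module" where
  "regular_module R = mk_module (carrier R) \<zero>\<^bsub>R\<^esub> (add R) (mult R)"

definition quot_module :: "('a, 'b, 'm) module_scheme \<Rightarrow> 'b set \<Rightarrow> ('a, 'b set) module" where
  "quot_module M N =
     mk_module (a_rcosets\<^bsub>M\<^esub> N) N (set_add M) (\<lambda>a X. \<Union>x\<in>X. N +>\<^bsub>M\<^esub> (a \<odot>\<^bsub>M\<^esub> x))"

definition module_iso ::
  "('a, 'r) ring_scheme \<Rightarrow> ('a, 'b, 'm) module_scheme \<Rightarrow> ('a, 'c, 'n) module_scheme \<Rightarrow> ('b \<Rightarrow> 'c) set"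
where
  "module_iso R M N =
     {f \<in> iso (add_monoid M) (add_monoid N).
        \<forall>a\<in>carrier R. \<forall>x\<in>carrier M. f (a \<odot>\<^bsub>M\<^esub> x) = a \<odot>\<^bsub>N\<^esub> f x}"

definition module_isomorphic ::
  "('a, 'r) ring_scheme \<Rightarrow> ('a, 'b, 'm) module_scheme \<Rightarrow> ('a, 'c, 'n) module_scheme \<Rightarrow> bool"
where
  "module_isomorphic R M N \<longleftrightarrow> module_iso R M N \<noteq> {}"

definition spanning :: "('a, 'r) ring_scheme \<Rightarrow> ('a, 'b, 'm) module_scheme \<Rightarrow> 'b set \<Rightarrow> bool" where
  "spanning R M B \<longleftrightarrow> B \<subseteq> carrier M \<and>
     (\<forall>x\<in>carrier M. \<exists>c\<in>B \<rightarrow> carrier R. x = (\<Oplus>\<^bsub>M\<^esub>b\<in>B. c b \<odot>\<^bsub>M\<^esub> b))"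

definition independent :: "('a, 'r) ring_scheme \<Rightarrow> ('a, 'b, 'm) module_scheme \<Rightarrow> 'b set \<Rightarrow> bool" where
  "independent R M B \<longleftrightarrow> B \<subseteq> carrier M \<and>
     (\<forall>c\<in>B \<rightarrow> carrier R. (\<Oplus>\<^bsub>M\<^esub>b\<in>B. c b \<odot>\<^bsub>M\<^esub> b) = \<zero>\<^bsub>M\<^esub> \<longrightarrow> (\<forall>b\<in>B. c b = \<zero>\<^bsub>R\<^esub>))"

definition finite_basis :: "('a, 'r) ring_scheme \<Rightarrow> ('a, 'b, 'm) module_scheme \<Rightarrow> 'b set \<Rightarrow> bool" where
  "finite_basis R M B \<longleftrightarrow> finite B \<and> spanning R M B \<and> independent R M B"

text \<open>Intended for finite-dimensional left vector spaces over a division ring; the value is 0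
  when there is no finite basis, as for the dimension in \<open>HOL.Vector_Spaces\<close>.\<close>

definition vdim :: "('a, 'r) ring_scheme \<Rightarrow> ('a, 'b, 'm) module_scheme \<Rightarrow> nat" where
  "vdim R M = (if \<exists>B. finite_basis R M B then card (SOME B. finite_basis R M B) else 0)"

text \<open>The \<open>R\<close>-subspaces of codimension \<open>s\<close>, i.e. of dimension \<open>vdim R M - s\<close>.\<close>

definition Gr_codim :: "('a, 'r) ring_scheme \<Rightarrow> ('a, 'b, 'm) module_scheme \<Rightarrow> nat \<Rightarrow> 'b set set" where
  "Gr_codim R M s = {U. submodule U R M \<and> vdim R (quot_module M U) = s}"

definition ideal_act :: "'a set \<Rightarrow> ('a, 'b, 'm) module_scheme \<Rightarrow> 'b set" where
  "ideal_act I M = generate (add_monoid M) {a \<odot>\<^bsub>M\<^esub> x | a x. a \<in> I \<and> x \<in> carrier M}"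

text \<open>HOL-Algebra's locale \<open>algebra\<close> is restricted to commutative algebras.\<close>

definition fin_dim_algebra :: "('k, 'r) ring_scheme \<Rightarrow> ('k, 'a) module \<Rightarrow> bool" where
  "fin_dim_algebra k \<Lambda> \<longleftrightarrow> field k \<and> ring \<Lambda> \<and> module k \<Lambda> \<and>
     (\<forall>a\<in>carrier k. \<forall>x\<in>carrier \<Lambda>. \<forall>y\<in>carrier \<Lambda>.
        (a \<odot>\<^bsub>\<Lambda>\<^esub> x) \<otimes>\<^bsub>\<Lambda>\<^esub> y = a \<odot>\<^bsub>\<Lambda>\<^esub> (x \<otimes>\<^bsub>\<Lambda>\<^esub> y) \<and>
        x \<otimes>\<^bsub>\<Lambda>\<^esub> (a \<odot>\<^bsub>\<Lambda>\<^esub> y) = a \<odot>\<^bsub>\<Lambda>\<^esub> (x \<otimes>\<^bsub>\<Lambda>\<^esub> y)) \<and>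
     (\<exists>B. finite B \<and> spanning k \<Lambda> B)"

definition left_ideal :: "'a set \<Rightarrow> ('a, 'r) ring_scheme \<Rightarrow> bool" where
  "left_ideal I R \<longleftrightarrow> submodule I R (regular_module R)"

definition maximal_left_ideal :: "'a set \<Rightarrow> ('a, 'r) ring_scheme \<Rightarrow> bool" where
  "maximal_left_ideal I R \<longleftrightarrow> left_ideal I R \<and> I \<noteq> carrier R \<and>
     (\<forall>I'. left_ideal I' R \<and> I \<subseteq> I' \<longrightarrow> I' = I \<or> I' = carrier R)"

definition jacobson_radical :: "('a, 'r) ring_scheme \<Rightarrow> 'a set" where
  "jacobson_radical R = carrier R \<inter> \<Inter>{I. maximal_left_ideal I R}"

primrec rad_pow :: "('a, 'r) ring_scheme \<Rightarrow> nat \<Rightarrow> 'a set" where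
  "rad_pow R 0 = carrier R"
| "rad_pow R (Suc m) = ideal_prod R (rad_pow R m) (jacobson_radical R)"

definition primitive_idempotent :: "('a, 'r) ring_scheme \<Rightarrow> 'a \<Rightarrow> bool" where
  "primitive_idempotent R e \<longleftrightarrow>
     e \<in> carrier R \<and> e \<otimes>\<^bsub>R\<^esub> e = e \<and> e \<noteq> \<zero>\<^bsub>R\<^esub> \<and>
     (\<forall>f\<in>carrier R. \<forall>g\<in>carrier R.
        f \<otimes>\<^bsub>R\<^esub> f = f \<and> g \<otimes>\<^bsub>R\<^esub> g = g \<and> f \<otimes>\<^bsub>R\<^esub> g = \<zero>\<^bsub>R\<^esub> \<and> g \<otimes>\<^bsub>R\<^esub> f = \<zero>\<^bsub>R\<^esub> \<and>
        e = f \<oplus>\<^bsub>R\<^esub> g \<longrightarrow> f = \<zero>\<^bsub>R\<^esub> \<or> g = \<zero>\<^bsub>R\<^esub>)"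

definition complete_primitive_orthogonal :: "('a, 'r) ring_scheme \<Rightarrow> nat \<Rightarrow> (nat \<Rightarrow> 'a) \<Rightarrow> bool" where
  "complete_primitive_orthogonal R t e \<longleftrightarrow>
     (\<forall>h\<in>{1..t}. primitive_idempotent R (e h)) \<and>
     (\<forall>g\<in>{1..t}. \<forall>h\<in>{1..t}. g \<noteq> h \<longrightarrow> e g \<otimes>\<^bsub>R\<^esub> e h = \<zero>\<^bsub>R\<^esub>) \<and>
     (\<Oplus>\<^bsub>R\<^esub>h\<in>{1..t}. e h) = \<one>\<^bsub>R\<^esub>"

definition proj :: "('a, 'r) ring_scheme \<Rightarrow> 'a \<Rightarrow> ('a, 'a) module" where
  "proj R f = (regular_module R)\<lparr>carrier := {x \<otimes>\<^bsub>R\<^esub> f | x. x \<in> carrier R}\<rparr>"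

definition basic_wrt :: "('a, 'r) ring_scheme \<Rightarrow> nat \<Rightarrow> (nat \<Rightarrow> 'a) \<Rightarrow> bool" where
  "basic_wrt R t e \<longleftrightarrow>
     (\<forall>g\<in>{1..t}. \<forall>h\<in>{1..t}. g \<noteq> h \<longrightarrow> \<not> module_isomorphic R (proj R (e g)) (proj R (e h)))"

definition corner :: "('a, 'r) ring_scheme \<Rightarrow> 'a \<Rightarrow> ('a, 'r) ring_scheme" where
  "corner R f = R\<lparr>carrier := {f \<otimes>\<^bsub>R\<^esub> x \<otimes>\<^bsub>R\<^esub> f | x. x \<in> carrier R}, one := f\<rparr>"

definition top_div :: "('a, 'r) ring_scheme \<Rightarrow> 'a \<Rightarrow> 'a set ring" where
  "top_div R f = corner R f Quot {f \<otimes>\<^bsub>R\<^esub> x \<otimes>\<^bsub>R\<^esub> f | x. x \<in> jacobson_radical R}"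

text \<open>
  Below \<open>f\<close> stands for \<open>e\<^sub>i\<close> and \<open>g\<close> for \<open>e\<^sub>j\<close>. A residue class \<open>c\<close> acts on
  \<open>V = g J\<^sup>n\<^sup>-\<^sup>1 f\<close> by multiplication with any of its representatives; the result does not
  depend on the representative when \<open>J\<^sup>n = 0\<close>, so the images below are then singletons.
\<close>

definition left_act :: "('a, 'r) ring_scheme \<Rightarrow> 'a set \<Rightarrow> 'a \<Rightarrow> 'a" where
  "left_act R c v = the_elem ((\<lambda>x. x \<otimes>\<^bsub>R\<^esub> v) ` c)"

definition right_act :: "('a, 'r) ring_scheme \<Rightarrow> 'a \<Rightarrow> 'a set \<Rightarrow> 'a" where
  "right_act R v c = the_elem ((\<lambda>x. v \<otimes>\<^bsub>R\<^esub> x) ` c)"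

definition V_space :: "('a, 'r) ring_scheme \<Rightarrow> nat \<Rightarrow> 'a \<Rightarrow> 'a \<Rightarrow> ('a set, 'a) module" where
  "V_space R n f g =
     mk_module {g \<otimes>\<^bsub>R\<^esub> x \<otimes>\<^bsub>R\<^esub> f | x. x \<in> rad_pow R (n - 1)} \<zero>\<^bsub>R\<^esub> (add R) (left_act R)"

definition right_transitive :: "('a, 'r) ring_scheme \<Rightarrow> 'a \<Rightarrow> 'a set set \<Rightarrow> bool" where
  "right_transitive R f \<G> \<longleftrightarrow>
     (\<forall>U\<in>\<G>. \<forall>U'\<in>\<G>. \<exists>d\<in>Units (top_div R f). (\<lambda>v. right_act R v d) ` U = U')"

definition W_part ::
  "('a, 'r) ring_scheme \<Rightarrow> nat \<Rightarrow> nat \<Rightarrow> (nat \<Rightarrow> 'a) \<Rightarrow> nat \<Rightarrow> nat \<Rightarrow> 'a set"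
where
  "W_part R n t e i j =
     {\<Oplus>\<^bsub>R\<^esub>h\<in>{1..t} - {j}. w h | w.
        \<forall>h\<in>{1..t} - {j}. w h \<in> {e h \<otimes>\<^bsub>R\<^esub> x | x. x \<in> ideal_act (rad_pow R (n - 1)) (proj R (e i))}}"

definition K_sub ::
  "('a, 'r) ring_scheme \<Rightarrow> nat \<Rightarrow> nat \<Rightarrow> (nat \<Rightarrow> 'a) \<Rightarrow> nat \<Rightarrow> nat \<Rightarrow> 'a set \<Rightarrow> 'a set"
where
  "K_sub R n t e i j U = W_part R n t e i j <+>\<^bsub>R\<^esub> U"

definition terminal_completion ::
  "('a, 'r) ring_scheme \<Rightarrow> nat \<Rightarrow> nat \<Rightarrow> (nat \<Rightarrow> 'a) \<Rightarrow> nat \<Rightarrow> nat \<Rightarrow> 'a set \<Rightarrow> ('a, 'a set) module"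
where
  "terminal_completion R n t e i j U = quot_module (proj R (e i)) (K_sub R n t e i j U)"

definition truncation ::
  "('a, 'r) ring_scheme \<Rightarrow> nat \<Rightarrow> ('a, 'b, 'm) module_scheme \<Rightarrow> ('a, 'b set) module"
where
  "truncation R d M = quot_module M (ideal_act (rad_pow R d) M)"

text \<open>The canonical map from \<open>M/J\<^sup>d\<^sup>+\<^sup>1M\<close> to \<open>M/J\<^sup>dM\<close>.\<close>

definition transition ::
  "('a, 'r) ring_scheme \<Rightarrow> nat \<Rightarrow> ('a, 'b, 'm) module_scheme \<Rightarrow> 'b set \<Rightarrow> 'b set"
where
  "transition R d M X = ideal_act (rad_pow R d) M <+>\<^bsub>M\<^esub> X"

text \<open>
  Having the same tower means isomorphism of inverse systems: isomorphisms in every degree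
  \<open>1 \<le> d < n\<close> that commute with the canonical maps.
\<close>

definition same_proper_tower ::
  "('a, 'r) ring_scheme \<Rightarrow> nat \<Rightarrow> ('a, 'b, 'm) module_scheme \<Rightarrow> ('a, 'b, 'm) module_scheme \<Rightarrow> bool"
where
  "same_proper_tower R n M N \<longleftrightarrow>
     (\<exists>\<phi>. (\<forall>d. 1 \<le> d \<and> d < n \<longrightarrow> \<phi> d \<in> module_iso R (truncation R d M) (truncation R d N)) \<and>
          (\<forall>d. 1 \<le> d \<and> Suc d < n \<longrightarrow>
             (\<forall>X\<in>carrier (truncation R (Suc d) M).
                transition R d N (\<phi> (Suc d) X) = \<phi> d (transition R d M X))))"

end

theory Submission
  imports Defs "HOL-Algebra.Embedded_Algebras"
begin

text \<open>
  Write \<open>f\<close> and \<open>g\<close> for the idempotents \<open>e\<^sub>i\<close> and \<open>e\<^sub>j\<close>, put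
  \<open>N = J\<^sup>n\<^sup>-\<^sup>1\<close> and \<open>P = \<Lambda>f\<close>. Since \<open>J N = N J = 0\<close>, all that happens on
  \<open>V = g N f\<close> can be computed with representatives of residue classes.

  The first step is to recognise \<open>K\<^sub>U = W\<^sub>j \<oplus> U\<close> as the set of all \<open>x \<in> N f\<close> with
  \<open>g x \<in> U\<close> (lemma \<open>K_eq\<close>). It is a submodule because \<open>e\<^sub>j \<Lambda> e\<^sub>h \<subseteq> J\<close> for
  \<open>h \<noteq> j\<close>, which is where basicness enters: an element of \<open>e\<^sub>j \<Lambda> e\<^sub>h\<close> outside \<open>J\<close>
  would generate \<open>\<Lambda>e\<^sub>h\<close> and split off an isomorphism \<open>\<Lambda>e\<^sub>j \<cong> \<Lambda>e\<^sub>h\<close>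
  (\<open>off_diagonal_radical\<close>).

  An isomorphism \<open>P/K\<^sub>U \<cong> P/K\<^sub>U\<^sub>'\<close> lifts along the cyclic generator \<open>f\<close> to right
  multiplication by some \<open>a \<in> f\<Lambda>f\<close> with \<open>x \<in> K\<^sub>U \<longleftrightarrow> x a \<in> K\<^sub>U\<^sub>'\<close>. If \<open>a\<close> lay in
  \<open>J\<close>, surjectivity would put \<open>f - c a\<close> into \<open>K\<^sub>U\<^sub>'\<close> for some \<open>c\<close>; multiplying on the left by
  \<open>V\<close> kills \<open>c a\<close> and gives \<open>U' = V\<close>, contrary to the codimension being positive. Hence
  \<open>a\<close> is a unit of the local ring \<open>f\<Lambda>f\<close>, and \<open>U a = U'\<close> (\<open>iso_imp_translate\<close>).
  Conversely right multiplication by a unit carrying \<open>U\<close> to \<open>U'\<close> carries \<open>K\<^sub>U\<close> to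
  \<open>K\<^sub>U\<^sub>'\<close> (\<open>translate_imp_iso\<close>). As the units of \<open>D\<^sub>i\<close> are exactly the classes of
  units of \<open>f\<Lambda>f\<close> (\<open>Units_top_div\<close>), two completions are isomorphic if and only if
  \<open>U\<close> and \<open>U'\<close> lie in one orbit. The argument is uniform in \<open>n \<ge> 1\<close>.

  Finally, \<open>K\<^sub>U \<subseteq> N \<subseteq> J\<^sup>d\<close> for \<open>d < n\<close>, so every \<open>M\<^sub>U/J\<^sup>dM\<^sub>U\<close> is canonically
  \<open>P/J\<^sup>dP\<close>: any two completions have the same proper tower
  (\<open>same_tower_of_deep_submodules\<close>), and the second equivalence is the negation of the first.

  The local structure of \<open>f\<Lambda>f\<close> rests on one consequence of finite dimension: the powers of an
  element \<open>c\<close> are linearly dependent, so \<open>c\<^sup>r = z c\<^sup>r\<^sup>+\<^sup>1\<close> for some \<open>z\<close> commuting with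
  \<open>c\<close>. Then \<open>z\<^sup>r c\<^sup>r\<close> is idempotent, so over a primitive idempotent every element is a unit
  or nilpotent.
\<close>

section \<open>Left modules and their quotients\<close>

text \<open>The axioms of the locale for modules over a commutative ring, which here has to be relaxed to
  arbitrary rings of scalars.\<close>

locale left_module = R?: ring R + M?: abelian_group M
  for R :: "('a, 'r) ring_scheme" (structure) and M :: "('a, 'b, 'm) module_scheme" (structure) +
  assumes smult_closed [simp, intro]:
      "\<lbrakk>a \<in> carrier R; x \<in> carrier M\<rbrakk> \<Longrightarrow> a \<odot>\<^bsub>M\<^esub> x \<in> carrier M"
    and smult_l_distr:
      "\<lbrakk>a \<in> carrier R; b \<in> carrier R; x \<in> carrier M\<rbrakk> \<Longrightarrow>
      (a \<oplus> b) \<odot>\<^bsub>M\<^esub> x = a \<odot>\<^bsub>M\<^esub> x \<oplus>\<^bsub>M\<^esub> b \<odot>\<^bsub>M\<^esub> x"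
    and smult_r_distr:
      "\<lbrakk>a \<in> carrier R; x \<in> carrier M; y \<in> carrier M\<rbrakk> \<Longrightarrow>
      a \<odot>\<^bsub>M\<^esub> (x \<oplus>\<^bsub>M\<^esub> y) = a \<odot>\<^bsub>M\<^esub> x \<oplus>\<^bsub>M\<^esub> a \<odot>\<^bsub>M\<^esub> y"
    and smult_assoc1:
      "\<lbrakk>a \<in> carrier R; b \<in> carrier R; x \<in> carrier M\<rbrakk> \<Longrightarrow>
      (a \<otimes> b) \<odot>\<^bsub>M\<^esub> x = a \<odot>\<^bsub>M\<^esub> (b \<odot>\<^bsub>M\<^esub> x)"
    and smult_one [simp]: "x \<in> carrier M \<Longrightarrow> \<one> \<odot>\<^bsub>M\<^esub> x = x"

definition module_epi ::
  "('a, 'r) ring_scheme \<Rightarrow> ('a, 'b, 'm) module_scheme \<Rightarrow> ('a, 'c, 'n) module_scheme \<Rightarrow> ('b \<Rightarrow> 'c) set"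
where
  "module_epi R M N =
     {f \<in> epi (add_monoid M) (add_monoid N).
        \<forall>a\<in>carrier R. \<forall>x\<in>carrier M. f (a \<odot>\<^bsub>M\<^esub> x) = a \<odot>\<^bsub>N\<^esub> f x}"

lemma module_epiD:
  assumes "f \<in> module_epi R M N"
  shows "x \<in> carrier M \<Longrightarrow> f x \<in> carrier N"
    and "z \<in> carrier N \<Longrightarrow> \<exists>x\<in>carrier M. z = f x"
    and "\<lbrakk>x \<in> carrier M; y \<in> carrier M\<rbrakk> \<Longrightarrow> f (x \<oplus>\<^bsub>M\<^esub> y) = f x \<oplus>\<^bsub>N\<^esub> f y"
    and "\<lbrakk>a \<in> carrier R; x \<in> carrier M\<rbrakk> \<Longrightarrow> f (a \<odot>\<^bsub>M\<^esub> x) = a \<odot>\<^bsub>N\<^esub> f x"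
  using assms by (auto simp: module_epi_def epi_def hom_def)

lemma module_epiI:
  assumes "\<And>x. x \<in> carrier M \<Longrightarrow> f x \<in> carrier N"
    and "\<And>z. z \<in> carrier N \<Longrightarrow> \<exists>x\<in>carrier M. f x = z"
    and "\<And>x y. \<lbrakk>x \<in> carrier M; y \<in> carrier M\<rbrakk> \<Longrightarrow> f (x \<oplus>\<^bsub>M\<^esub> y) = f x \<oplus>\<^bsub>N\<^esub> f y"
    and "\<And>a x. \<lbrakk>a \<in> carrier R; x \<in> carrier M\<rbrakk> \<Longrightarrow> f (a \<odot>\<^bsub>M\<^esub> x) = a \<odot>\<^bsub>N\<^esub> f x"
  shows "f \<in> module_epi R M N"
  using assms by (fastforce simp: module_epi_def epi_def hom_def image_iff)

lemma module_isoD: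
  assumes "f \<in> module_iso R M N"
  shows "x \<in> carrier M \<Longrightarrow> f x \<in> carrier N"
    and "bij_betw f (carrier M) (carrier N)"
    and "\<lbrakk>x \<in> carrier M; y \<in> carrier M\<rbrakk> \<Longrightarrow> f (x \<oplus>\<^bsub>M\<^esub> y) = f x \<oplus>\<^bsub>N\<^esub> f y"
    and "\<lbrakk>a \<in> carrier R; x \<in> carrier M\<rbrakk> \<Longrightarrow> f (a \<odot>\<^bsub>M\<^esub> x) = a \<odot>\<^bsub>N\<^esub> f x"
  using assms by (auto simp: module_iso_def iso_def hom_def)

lemma module_epi_comp:
  assumes "f \<in> module_epi R M N" "h \<in> module_epi R N P"
  shows "h \<circ> f \<in> module_epi R M P"
proof (rule module_epiI)
  fix z assume "z \<in> carrier P"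
  then obtain y where y: "y \<in> carrier N" "z = h y" using module_epiD(2)[OF assms(2)] by meson
  then obtain x where "x \<in> carrier M" "y = f x" using module_epiD(2)[OF assms(1)] by meson
  then show "\<exists>x\<in>carrier M. (h \<circ> f) x = z" using y by auto
qed (simp_all add: module_epiD(1,3,4)[OF assms(1)] module_epiD(1,3,4)[OF assms(2)])

text \<open>The only device used to construct isomorphisms of quotients and of iterated quotients: it
  compares two presentations by the same module instead of handling cosets of cosets.\<close>

lemma induced_module_iso:
  assumes M: "left_module R M"
    and q: "q \<in> module_epi R M A" and q': "q' \<in> module_epi R M A'"
    and fibres: "\<And>x y. \<lbrakk>x \<in> carrier M; y \<in> carrier M\<rbrakk> \<Longrightarrow> q x = q y \<longleftrightarrow> q' x = q' y"
  obtains \<phi> where "\<phi> \<in> module_iso R A A'" "\<And>x. x \<in> carrier M \<Longrightarrow> \<phi> (q x) = q' x"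
proof
  interpret left_module R M by fact
  define \<phi> where "\<phi> z = q' (SOME x. x \<in> carrier M \<and> q x = z)" for z
  show \<phi>: "\<phi> (q x) = q' x" if "x \<in> carrier M" for x
  proof -
    have "(SOME y. y \<in> carrier M \<and> q y = q x) \<in> carrier M \<and> q (SOME y. y \<in> carrier M \<and> q y = q x) = q x"
      by (rule someI[of _ x]) (use that in simp)
    then show ?thesis unfolding \<phi>_def using fibres that by blast
  qed
  have A: "\<exists>x\<in>carrier M. z = q x" if "z \<in> carrier A" for z
    using module_epiD(2)[OF q that] .
  have A': "\<exists>x\<in>carrier M. z = q' x" if "z \<in> carrier A'" for z
    using module_epiD(2)[OF q' that] .
  have "\<phi> \<in> hom (add_monoid A) (add_monoid A')"
  proof (rule homI)
    fix z assume "z \<in> carrier (add_monoid A)"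
    then obtain x where "x \<in> carrier M" "z = q x" using A by auto
    then show "\<phi> z \<in> carrier (add_monoid A')" using \<phi> module_epiD(1)[OF q'] by simp
  next
    fix z w assume "z \<in> carrier (add_monoid A)" "w \<in> carrier (add_monoid A)"
    then obtain x y where xy: "x \<in> carrier M" "z = q x" "y \<in> carrier M" "w = q y"
      using A[of z] A[of w] by auto
    then have "z \<oplus>\<^bsub>A\<^esub> w = q (x \<oplus>\<^bsub>M\<^esub> y)" by (simp add: module_epiD(3)[OF q])
    with xy show "\<phi> (z \<otimes>\<^bsub>add_monoid A\<^esub> w) = \<phi> z \<otimes>\<^bsub>add_monoid A'\<^esub> \<phi> w"
      by (simp add: \<phi> module_epiD(3)[OF q'])
  qed
  moreover have "bij_betw \<phi> (carrier A) (carrier A')"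
  proof (rule bij_betw_imageI)
    show "inj_on \<phi> (carrier A)"
    proof (rule inj_onI)
      fix z w assume "z \<in> carrier A" "w \<in> carrier A" and eq: "\<phi> z = \<phi> w"
      then obtain x y where xy: "x \<in> carrier M" "z = q x" "y \<in> carrier M" "w = q y" using A by meson
      then show "z = w" using eq \<phi> fibres by metis
    qed
    show "\<phi> ` carrier A = carrier A'"
    proof
      show "\<phi> ` carrier A \<subseteq> carrier A'" using A \<phi> module_epiD(1)[OF q'] by fastforce
      show "carrier A' \<subseteq> \<phi> ` carrier A"
      proof
        fix z assume "z \<in> carrier A'"
        then obtain x where "x \<in> carrier M" "z = q' x" using A' by blast
        then show "z \<in> \<phi> ` carrier A" using \<phi> module_epiD(1)[OF q] by (metis imageI)
      qed
    qed
  qed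
  moreover have "\<phi> (a \<odot>\<^bsub>A\<^esub> z) = a \<odot>\<^bsub>A'\<^esub> \<phi> z" if a: "a \<in> carrier R" and "z \<in> carrier A" for a z
  proof -
    obtain x where x: "x \<in> carrier M" "z = q x" using A \<open>z \<in> carrier A\<close> by blast
    then have "a \<odot>\<^bsub>A\<^esub> z = q (a \<odot>\<^bsub>M\<^esub> x)" using a by (simp add: module_epiD(4)[OF q])
    with x a show ?thesis by (simp add: \<phi> module_epiD(4)[OF q'])
  qed
  ultimately show "\<phi> \<in> module_iso R A A'" by (simp add: module_iso_def iso_def)
qed

lemma quot_module_sel [simp]:
  "carrier (quot_module M N) = a_rcosets\<^bsub>M\<^esub> N"
  "zero (quot_module M N) = N"
  "add (quot_module M N) = set_add M"
  "smult (quot_module M N) a X = (\<Union>x\<in>X. N +>\<^bsub>M\<^esub> (a \<odot>\<^bsub>M\<^esub> x))"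
  by (simp_all add: quot_module_def mk_module_def)

lemma quot_module_add_group:
  assumes "abelian_subgroup H M"
  shows "abelian_group (quot_module M H)"
proof -
  interpret H: abelian_subgroup H M by fact
  interpret F: comm_group "M A_Mod H" by (rule H.a_factorgroup_is_comm_group)
  have F: "carrier (M A_Mod H) = a_rcosets\<^bsub>M\<^esub> H" "mult (M A_Mod H) = set_add M" "one (M A_Mod H) = H"
    by (simp_all add: A_FactGroup_def FactGroup_def A_RCOSETS_def set_add_def)
  show ?thesis
  proof (rule abelian_groupI)
    fix x assume "x \<in> carrier (quot_module M H)"
    then show "\<exists>y\<in>carrier (quot_module M H). y \<oplus>\<^bsub>quot_module M H\<^esub> x = \<zero>\<^bsub>quot_module M H\<^esub>"
      using F.l_inv_ex[unfolded F] by simp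
  qed (use F.m_closed[unfolded F] F.one_closed[unfolded F] F.m_assoc[unfolded F]
      F.m_comm[unfolded F] F.l_one[unfolded F] in simp_all)
qed

context left_module
begin

lemma submodule_abelian_subgroup:
  assumes "submodule N R M" shows "abelian_subgroup N M"
proof (rule abelian_subgroupI3)
  show "additive_subgroup N M"
    using assms by (simp add: additive_subgroup_def submodule_def)
qed (rule M.abelian_group_axioms)

lemma submoduleI:
  assumes "N \<subseteq> carrier M" "\<zero>\<^bsub>M\<^esub> \<in> N"
    and "\<And>x y. \<lbrakk>x \<in> N; y \<in> N\<rbrakk> \<Longrightarrow> x \<oplus>\<^bsub>M\<^esub> y \<in> N"
    and smult: "\<And>a x. \<lbrakk>a \<in> carrier R; x \<in> N\<rbrakk> \<Longrightarrow> a \<odot>\<^bsub>M\<^esub> x \<in> N"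
  shows "submodule N R M"
proof (intro submodule.intro subgroup.intro submodule_axioms.intro)
  fix x assume x: "x \<in> N"
  then have xM: "x \<in> carrier M" using assms by auto
  \<comment> \<open>Negatives come for free from the action of \<open>\<ominus> \<one>\<close>.\<close>
  have "(\<ominus> \<one>) \<odot>\<^bsub>M\<^esub> x \<oplus>\<^bsub>M\<^esub> x = (\<ominus> \<one> \<oplus> \<one>) \<odot>\<^bsub>M\<^esub> x"
    using xM by (simp add: smult_l_distr)
  also have "\<dots> = \<zero> \<odot>\<^bsub>M\<^esub> x" by (simp add: R.l_neg)
  also have "\<dots> = \<zero>\<^bsub>M\<^esub>"
    using smult_l_distr[of \<zero> \<zero> x] xM by (metis M.add.r_cancel_one' R.l_zero R.zero_closed smult_closed)
  finally have "\<ominus>\<^bsub>M\<^esub> x = (\<ominus> \<one>) \<odot>\<^bsub>M\<^esub> x"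
    using xM by (simp add: M.minus_equality)
  then show "inv\<^bsub>add_monoid M\<^esub> x \<in> N" using smult[of "\<ominus> \<one>" x] x by (simp add: a_inv_def)
qed (use assms in auto)

end

locale quotient_module = left_module + 
  fixes N assumes N: "submodule N R M"

sublocale quotient_module \<subseteq> N?: abelian_subgroup N M
  using submodule_abelian_subgroup[OF N] .

context quotient_module
begin

lemma quot_smult:
  assumes a: "a \<in> carrier R" and x: "x \<in> carrier M"
  shows "a \<odot>\<^bsub>quot_module M N\<^esub> (N +>\<^bsub>M\<^esub> x) = N +>\<^bsub>M\<^esub> (a \<odot>\<^bsub>M\<^esub> x)"
proof -
  have "N +>\<^bsub>M\<^esub> (a \<odot>\<^bsub>M\<^esub> y) = N +>\<^bsub>M\<^esub> (a \<odot>\<^bsub>M\<^esub> x)" if "y \<in> N +>\<^bsub>M\<^esub> x" for y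
  proof -
    obtain h where h: "h \<in> N" "y = h \<oplus>\<^bsub>M\<^esub> x" using \<open>y \<in> _\<close> by (auto simp: a_r_coset_def')
    have "a \<odot>\<^bsub>M\<^esub> y = a \<odot>\<^bsub>M\<^esub> h \<oplus>\<^bsub>M\<^esub> a \<odot>\<^bsub>M\<^esub> x" using h a x by (simp add: smult_r_distr)
    moreover have "a \<odot>\<^bsub>M\<^esub> h \<in> N" using submodule.smult_closed[OF N] a h by blast
    ultimately have "a \<odot>\<^bsub>M\<^esub> y \<in> N +>\<^bsub>M\<^esub> (a \<odot>\<^bsub>M\<^esub> x)" by (auto simp: a_r_coset_def')
    then show ?thesis using a_repr_independence'[of "a \<odot>\<^bsub>M\<^esub> y" "a \<odot>\<^bsub>M\<^esub> x"] a x by simp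
  qed
  moreover have "N +>\<^bsub>M\<^esub> x \<noteq> {}" using a_rcos_self[OF x] by auto
  ultimately show ?thesis by auto
qed

lemma quot_carrierE:
  assumes "X \<in> carrier (quot_module M N)"
  obtains x where "x \<in> carrier M" "X = N +>\<^bsub>M\<^esub> x"
  using assms by (auto simp: A_RCOSETS_def')

lemma quot_carrierI: "x \<in> carrier M \<Longrightarrow> N +>\<^bsub>M\<^esub> x \<in> carrier (quot_module M N)"
  by (auto simp: A_RCOSETS_def')

lemma coset_eq_iff:
  assumes "x \<in> carrier M" "y \<in> carrier M"
  shows "N +>\<^bsub>M\<^esub> x = N +>\<^bsub>M\<^esub> y \<longleftrightarrow> x \<ominus>\<^bsub>M\<^esub> y \<in> N"
  using a_rcos_module[OF assms(2,1)] a_repr_independence'[OF _ assms(2)] a_rcos_self[OF assms(1)]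
  by (auto simp: a_minus_def)

lemma left_module_quot: "left_module R (quot_module M N)"
proof -
  interpret Q: abelian_group "quot_module M N"
    by (rule quot_module_add_group) (rule N.abelian_subgroup_axioms)
  show ?thesis
  proof (unfold_locales, goal_cases)
    case (1 a X)
    then show ?case by (metis quot_carrierE quot_carrierI quot_smult smult_closed)
  next
    case (2 a b X)
    then obtain x where "x \<in> carrier M" "X = N +>\<^bsub>M\<^esub> x" by (elim quot_carrierE)
    with 2 show ?case
      by (simp only: quot_smult R.a_closed smult_l_distr quot_module_sel(3)) (simp add: a_rcos_sum)
  next
    case (3 a X Y)
    then obtain x y where "x \<in> carrier M" "X = N +>\<^bsub>M\<^esub> x" "y \<in> carrier M" "Y = N +>\<^bsub>M\<^esub> y"
      by (metis quot_carrierE)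
    with 3 show ?case
      by (simp only: quot_smult quot_module_sel(3) a_rcos_sum M.a_closed smult_r_distr smult_closed)
  next
    case (4 a b X)
    then obtain x where "x \<in> carrier M" "X = N +>\<^bsub>M\<^esub> x" by (elim quot_carrierE)
    with 4 show ?case by (simp only: quot_smult smult_assoc1 smult_closed R.m_closed)
  next
    case (5 X)
    then obtain x where "x \<in> carrier M" "X = N +>\<^bsub>M\<^esub> x" by (elim quot_carrierE)
    then show ?case by (simp only: quot_smult smult_one R.one_closed)
  qed
qed

lemma coset_map_epi: "(\<lambda>x. N +>\<^bsub>M\<^esub> x) \<in> module_epi R M (quot_module M N)"
proof (rule module_epiI)
  show "\<exists>x\<in>carrier M. N +>\<^bsub>M\<^esub> x = X" if "X \<in> carrier (quot_module M N)" for X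
    using that by (metis quot_carrierE)
qed (simp_all only: quot_carrierI quot_smult a_rcos_sum quot_module_sel(3))

end

lemma submodule_image:
  assumes M: "left_module R M" and A: "left_module R A"
    and q: "q \<in> module_epi R M A" and L: "submodule L R M"
  shows "submodule (q ` L) R A"
proof -
  interpret M: left_module R M by fact
  interpret A: left_module R A by fact
  interpret L: abelian_subgroup L M by (rule M.submodule_abelian_subgroup[OF L])
  note qs = module_epiD[OF q]
  have "q \<zero>\<^bsub>M\<^esub> \<oplus>\<^bsub>A\<^esub> q \<zero>\<^bsub>M\<^esub> = q \<zero>\<^bsub>M\<^esub>" 
    using module_epiD(3)[OF q, of "\<zero>\<^bsub>M\<^esub>" "\<zero>\<^bsub>M\<^esub>"] by simp
  then have z: "q \<zero>\<^bsub>M\<^esub> = \<zero>\<^bsub>A\<^esub>"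
    using A.M.add.r_cancel_one[of "q \<zero>\<^bsub>M\<^esub>" "q \<zero>\<^bsub>M\<^esub>"] qs(1)[of "\<zero>\<^bsub>M\<^esub>"] by simp
  have add: "x \<oplus>\<^bsub>A\<^esub> y \<in> q ` L" if xy: "x \<in> q ` L" "y \<in> q ` L" for x y
  proof -
    obtain u v where uv: "u \<in> L" "v \<in> L" "x = q u" "y = q v" using xy by blast
    then have "x \<oplus>\<^bsub>A\<^esub> y = q (u \<oplus>\<^bsub>M\<^esub> v)" using qs(3) L.a_Hcarr by metis
    then show ?thesis using L.a_closed[OF uv(1,2)] by blast
  qed
  have smult: "a \<odot>\<^bsub>A\<^esub> x \<in> q ` L" if ax: "a \<in> carrier R" "x \<in> q ` L" for a x
  proof -
    obtain u where u: "u \<in> L" "x = q u" using ax by blast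
    then have "a \<odot>\<^bsub>A\<^esub> x = q (a \<odot>\<^bsub>M\<^esub> u)" using ax qs(4) L.a_Hcarr by metis
    then show ?thesis using submodule.smult_closed[OF L ax(1) u(1)] by blast
  qed
  have sub: "q ` L \<subseteq> carrier A" using L.a_subset module_epiD(1)[OF q] by blast
  have zero: "\<zero>\<^bsub>A\<^esub> \<in> q ` L" using imageI[OF L.zero_closed, of q] unfolding z .
  show ?thesis by (rule A.submoduleI[OF sub zero add smult])
qed

section \<open>The Jacobson radical\<close>

lemma regular_module_sel [simp]:
  "carrier (regular_module R) = carrier R" "zero (regular_module R) = zero R"
  "add (regular_module R) = add R" "smult (regular_module R) = mult R"
  by (simp_all add: regular_module_def mk_module_def)

lemma proj_sel [simp]:
  "carrier (proj R f) = {x \<otimes>\<^bsub>R\<^esub> f | x. x \<in> carrier R}" "zero (proj R f) = zero R"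
  "add (proj R f) = add R" "smult (proj R f) = mult R"
  by (simp_all add: proj_def)

context ring
begin

lemma left_module_proj:
  assumes f: "f \<in> carrier R"
  shows "left_module R (proj R f)"
proof -
  have "abelian_group (proj R f)"
  proof (rule abelian_groupI)
    fix x y assume "x \<in> carrier (proj R f)" "y \<in> carrier (proj R f)"
    then obtain u v where "u \<in> carrier R" "v \<in> carrier R" "x = u \<otimes> f" "y = v \<otimes> f" by auto
    then have "x \<oplus> y = (u \<oplus> v) \<otimes> f" using f by (simp add: l_distr)
    then show "x \<oplus>\<^bsub>proj R f\<^esub> y \<in> carrier (proj R f)"
      using \<open>u \<in> _\<close> \<open>v \<in> _\<close> by auto
  next
    show "\<zero>\<^bsub>proj R f\<^esub> \<in> carrier (proj R f)"
      using f by (auto intro!: exI[of _ \<zero>])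
  next
    fix x assume "x \<in> carrier (proj R f)"
    then obtain u where u: "u \<in> carrier R" "x = u \<otimes> f" by auto
    then have "(\<ominus> u) \<otimes> f \<oplus>\<^bsub>proj R f\<^esub> x = \<zero>\<^bsub>proj R f\<^esub>" using f by (simp add: l_minus l_neg)
    moreover have "(\<ominus> u) \<otimes> f \<in> carrier (proj R f)"
      using a_inv_closed[OF u(1)] unfolding proj_sel(1) by blast
    ultimately show "\<exists>y\<in>carrier (proj R f). y \<oplus>\<^bsub>proj R f\<^esub> x = \<zero>\<^bsub>proj R f\<^esub>" by (rule bexI)
  qed (use f in \<open>auto simp: a_ac\<close>)
  moreover have "\<exists>y. a \<otimes> (x \<otimes> f) = y \<otimes> f \<and> y \<in> carrier R" if "a \<in> carrier R" "x \<in> carrier R" for a x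
    using that f by (intro exI[of _ "a \<otimes> x"]) (simp add: m_assoc)
  ultimately show ?thesis
    using ring_axioms f
    by (auto intro!: left_module.intro left_module_axioms.intro simp: l_distr r_distr m_assoc)
qed

lemma left_ideal_iff:
  "left_ideal I R \<longleftrightarrow> I \<subseteq> carrier R \<and> \<zero> \<in> I \<and> (\<forall>x\<in>I. \<forall>y\<in>I. x \<oplus> y \<in> I) \<and>
     (\<forall>a\<in>carrier R. \<forall>x\<in>I. a \<otimes> x \<in> I)"
proof -
  have "left_module R (regular_module R)"
  proof -
    have "abelian_group (regular_module R)"
      by (rule abelian_groupI) (auto simp: a_ac intro!: bexI[of _ "\<ominus> x" for x] l_neg)
    then show ?thesis using ring_axioms
      by (auto intro!: left_module.intro left_module_axioms.intro simp: l_distr r_distr m_assoc)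
  qed
  then interpret L: left_module R "regular_module R" .
  show ?thesis
  proof
    assume "left_ideal I R"
    then interpret I: submodule I R "regular_module R" by (simp add: left_ideal_def)
    show "I \<subseteq> carrier R \<and> \<zero> \<in> I \<and> (\<forall>x\<in>I. \<forall>y\<in>I. x \<oplus> y \<in> I) \<and>
     (\<forall>a\<in>carrier R. \<forall>x\<in>I. a \<otimes> x \<in> I)"
      using I.subset I.one_closed I.m_closed I.smult_closed by auto
  next
    assume "I \<subseteq> carrier R \<and> \<zero> \<in> I \<and> (\<forall>x\<in>I. \<forall>y\<in>I. x \<oplus> y \<in> I) \<and>
     (\<forall>a\<in>carrier R. \<forall>x\<in>I. a \<otimes> x \<in> I)"
    then show "left_ideal I R"
      unfolding left_ideal_def by (intro L.submoduleI) auto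
  qed
qed

lemma left_idealD:
  assumes "left_ideal I R"
  shows "I \<subseteq> carrier R" "\<zero> \<in> I" "\<lbrakk>x \<in> I; y \<in> I\<rbrakk> \<Longrightarrow> x \<oplus> y \<in> I"
    "\<lbrakk>a \<in> carrier R; x \<in> I\<rbrakk> \<Longrightarrow> a \<otimes> x \<in> I"
    "x \<in> I \<Longrightarrow> \<ominus> x \<in> I"
proof -
  show I: "I \<subseteq> carrier R" "\<zero> \<in> I" "\<lbrakk>x \<in> I; y \<in> I\<rbrakk> \<Longrightarrow> x \<oplus> y \<in> I"
    and mult: "\<And>a x. \<lbrakk>a \<in> carrier R; x \<in> I\<rbrakk> \<Longrightarrow> a \<otimes> x \<in> I"
    using assms unfolding left_ideal_iff by auto
  assume "x \<in> I"
  then show "\<ominus> x \<in> I" using mult[of "\<ominus> \<one>" x] I by (auto simp: l_minus subset_iff)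
qed

lemma maximal_left_ideal_sum:
  assumes I: "maximal_left_ideal I R" and x: "x \<in> carrier R" "x \<notin> I" and w: "w \<in> carrier R"
  obtains y b where "y \<in> carrier R" "b \<in> I" "w = y \<otimes> x \<oplus> b"
proof -
  define L where "L = {y \<otimes> x \<oplus> b | y b. y \<in> carrier R \<and> b \<in> I}"
  have I': "left_ideal I R" using I by (simp add: maximal_left_ideal_def)
  note I'' = left_idealD[OF I']
  have carr [simp]: "b \<in> I \<Longrightarrow> b \<in> carrier R" for b using I'' by auto
  have L: "y \<otimes> x \<oplus> b \<in> L" if "y \<in> carrier R" "b \<in> I" for y b using that by (auto simp: L_def)
  have "left_ideal L R"
    unfolding left_ideal_iff
  proof (intro conjI ballI)
    show "L \<subseteq> carrier R" using x by (auto simp: L_def)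
    show "\<zero> \<in> L" using L[of \<zero> \<zero>] x I'' by simp
  next
    fix u v assume "u \<in> L" "v \<in> L"
    then obtain y b y' b' where "y \<in> carrier R" "b \<in> I" "u = y \<otimes> x \<oplus> b"
      "y' \<in> carrier R" "b' \<in> I" "v = y' \<otimes> x \<oplus> b'" by (auto simp: L_def)
    then have "u \<oplus> v = (y \<oplus> y') \<otimes> x \<oplus> (b \<oplus> b')" "y \<oplus> y' \<in> carrier R" "b \<oplus> b' \<in> I"
      using x I'' by (simp_all add: l_distr a_ac)
    then show "u \<oplus> v \<in> L" using L by simp
  next
    fix a u assume a: "a \<in> carrier R" and "u \<in> L"
    then obtain y b where "y \<in> carrier R" "b \<in> I" "u = y \<otimes> x \<oplus> b" by (auto simp: L_def)
    then have "a \<otimes> u = (a \<otimes> y) \<otimes> x \<oplus> a \<otimes> b" "a \<otimes> y \<in> carrier R" "a \<otimes> b \<in> I"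
      using x a I'' by (simp_all add: r_distr m_assoc)
    then show "a \<otimes> u \<in> L" using L by simp
  qed
  moreover have "I \<subseteq> L"
  proof
    fix b assume "b \<in> I"
    then show "b \<in> L" using L[of \<zero> b] x by simp
  qed
  moreover have "x \<in> L" using L[of \<one> \<zero>] x I'' by simp
  ultimately have "L = carrier R" using I x by (auto simp: maximal_left_ideal_def)
  then show thesis using w that by (auto simp: L_def)
qed

text \<open>For a maximal left ideal \<open>I\<close> and \<open>r \<in> R\<close>, the left ideal of all \<open>y\<close> with
  \<open>y r \<in> I\<close> is either all of \<open>R\<close> or again maximal, since \<open>y \<mapsto> y r\<close> embeds its quotient into
  the simple module \<open>R/I\<close>. Either way it contains the radical.\<close>

lemma jacobson_radical_r_closed:
  assumes x: "x \<in> jacobson_radical R" and r: "r \<in> carrier R"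
  shows "x \<otimes> r \<in> jacobson_radical R"
proof -
  have xR: "x \<in> carrier R" using x by (simp add: jacobson_radical_def)
  have "x \<otimes> r \<in> I" if I: "maximal_left_ideal I R" for I
  proof -
    have I': "left_ideal I R" using I by (simp add: maximal_left_ideal_def)
    note I'' = left_idealD[OF I']
    define A where "A = {y \<in> carrier R. y \<otimes> r \<in> I}"
    have A: "left_ideal A R"
      unfolding left_ideal_iff using r I'' by (auto simp: A_def l_distr m_assoc)
    show ?thesis
    proof (cases "A = carrier R")
      case True
      then show ?thesis using xR by (auto simp: A_def)
    next
      case False
      have "maximal_left_ideal A R"
        unfolding maximal_left_ideal_def
      proof (intro conjI allI impI A False)
        fix I2 assume I2: "left_ideal I2 R \<and> A \<subseteq> I2"
        note I2' = left_idealD[OF conjunct1[OF I2]]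
        show "I2 = A \<or> I2 = carrier R"
        proof (rule disjCI)
          assume "I2 \<noteq> carrier R"
          show "I2 = A"
          proof (rule ccontr)
            assume "I2 \<noteq> A"
            then obtain y where y: "y \<in> I2" "y \<notin> A" using I2 by auto
            then have yR: "y \<in> carrier R" "y \<otimes> r \<notin> I" using I2'(1) by (auto simp: A_def)
            obtain z b where zb: "z \<in> carrier R" "b \<in> I" "r = z \<otimes> (y \<otimes> r) \<oplus> b"
              using maximal_left_ideal_sum[OF I _ yR(2) r] yR r by auto
            have bR: "b \<in> carrier R" using zb I'' by auto
            have "(\<one> \<ominus> z \<otimes> y) \<otimes> r = r \<ominus> z \<otimes> (y \<otimes> r)"
              using zb yR r by (simp add: a_minus_def l_distr l_minus m_assoc)
            also have "\<dots> = b"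
            proof -
              have "z \<otimes> (y \<otimes> r) \<oplus> b \<ominus> z \<otimes> (y \<otimes> r) = b"
                using zb(1) yR r bR by (simp add: a_minus_def a_ac r_neg1 r_neg2 r_neg)
              then show ?thesis using zb(3) by simp
            qed
            finally have "\<one> \<ominus> z \<otimes> y \<in> A" using zb yR r by (simp add: A_def)
            then have "\<one> \<ominus> z \<otimes> y \<in> I2" "z \<otimes> y \<in> I2" using I2 I2' y zb by auto
            then have "(\<one> \<ominus> z \<otimes> y) \<oplus> z \<otimes> y \<in> I2" using I2' by blast
            moreover have "(\<one> \<ominus> z \<otimes> y) \<oplus> z \<otimes> y = \<one>"
              using zb yR by (simp add: a_minus_def a_assoc l_neg)
            ultimately have "\<one> \<in> I2" by simp
            then have "c \<in> I2" if "c \<in> carrier R" for c using I2'(4)[OF that] that by fastforce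
            then show False using \<open>I2 \<noteq> carrier R\<close> I2'(1) by auto
          qed
        qed
      qed
      then have "x \<in> A" using x by (auto simp: jacobson_radical_def)
      then show ?thesis by (simp add: A_def)
    qed
  qed
  then show ?thesis using xR r by (auto simp: jacobson_radical_def)
qed

lemma jacobson_radical_ideal: "ideal (jacobson_radical R) R"
proof -
  have I: "left_ideal I R" if "maximal_left_ideal I R" for I
    using that by (simp add: maximal_left_ideal_def)
  have J: "left_ideal (jacobson_radical R) R"
    unfolding left_ideal_iff using left_idealD[OF I] by (auto simp: jacobson_radical_def)
  note J' = left_idealD[OF J]
  show ?thesis
  proof (rule idealI)
    show "subgroup (jacobson_radical R) (add_monoid R)"
      using J' by (auto intro!: subgroup.intro simp: a_inv_def)
  qed (use J' jacobson_radical_r_closed ring_axioms in auto)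
qed

text \<open>If \<open>r\<close> avoids the maximal left ideal \<open>I\<close>, then \<open>R r + I = R\<close>, so some
  \<open>1 - y r\<close> lies in \<open>I\<close> and cannot be left invertible.\<close>

lemma not_jacobson_radicalE:
  assumes "r \<in> carrier R" "r \<notin> jacobson_radical R"
  obtains y where "y \<in> carrier R" "\<And>x. x \<in> carrier R \<Longrightarrow> x \<otimes> (\<one> \<ominus> y \<otimes> r) \<noteq> \<one>"
proof -
  obtain I where I: "maximal_left_ideal I R" "r \<notin> I" using assms by (auto simp: jacobson_radical_def)
  have I': "left_ideal I R" "I \<noteq> carrier R" using I by (simp_all add: maximal_left_ideal_def)
  obtain y b where yb: "y \<in> carrier R" "b \<in> I" "\<one> = y \<otimes> r \<oplus> b"
    using maximal_left_ideal_sum[OF I(1) assms(1) I(2), of \<one>] by auto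
  have bR: "b \<in> carrier R" using yb left_idealD[OF I'(1)] by auto
  have "\<one> \<ominus> y \<otimes> r = b"
  proof -
    have "y \<otimes> r \<oplus> b \<ominus> y \<otimes> r = b"
      using yb(1) assms bR by (simp add: a_minus_def a_ac r_neg1 r_neg2 r_neg)
    then show ?thesis using yb(3) by simp
  qed
  moreover have "x \<otimes> b \<noteq> \<one>" if "x \<in> carrier R" for x
  proof
    assume "x \<otimes> b = \<one>"
    then have "\<one> \<in> I" using left_idealD(4)[OF I'(1) that yb(2)] by simp
    then have "c \<in> I" if "c \<in> carrier R" for c
      using left_idealD(4)[OF I'(1) that] that by fastforce
    then show False using I'(2) left_idealD(1)[OF I'(1)] by auto
  qed
  ultimately show thesis using that[of y] yb by simp
qed

lemma rad_pow_ideal: "ideal (rad_pow R m) R"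
  by (induction m) (simp_all add: oneideal ideal_prod_is_ideal jacobson_radical_ideal)

lemma rad_pow_Suc_mult:
  "\<lbrakk>x \<in> rad_pow R m; y \<in> jacobson_radical R\<rbrakk> \<Longrightarrow> x \<otimes> y \<in> rad_pow R (Suc m)"
  by (simp add: ideal_prod.prod)

lemma rad_pow_Suc_subset: "rad_pow R (Suc m) \<subseteq> rad_pow R m"
  using ideal_prod_inter[OF rad_pow_ideal jacobson_radical_ideal] by auto

lemma rad_pow_antimono: "d \<le> m \<Longrightarrow> rad_pow R m \<subseteq> rad_pow R d"
  by (rule lift_Suc_antimono_le[of "rad_pow R"]) (use rad_pow_Suc_subset in auto)

text \<open>The powers are built by multiplying with the radical on the right; this lemma supplies the
  multiplication on the left.\<close>

lemma rad_pow_Suc_mult':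
  "\<lbrakk>y \<in> jacobson_radical R; x \<in> rad_pow R m\<rbrakk> \<Longrightarrow> y \<otimes> x \<in> rad_pow R (Suc m)"
proof (induction m arbitrary: x)
  case 0
  interpret J: ideal "jacobson_radical R" R by (rule jacobson_radical_ideal)
  have "\<one> \<otimes> (y \<otimes> x) \<in> rad_pow R (Suc 0)"
    by (rule rad_pow_Suc_mult) (use 0 J.I_r_closed in auto)
  then show ?case using 0 J.Icarr by simp
next
  case (Suc m)
  interpret J: ideal "jacobson_radical R" R by (rule jacobson_radical_ideal)
  interpret N: ideal "rad_pow R m" R by (rule rad_pow_ideal)
  interpret N2: ideal "rad_pow R (Suc (Suc m))" R by (rule rad_pow_ideal)
  have "x \<in> ideal_prod R (rad_pow R m) (jacobson_radical R)" using Suc by simp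
  then have "x \<in> carrier R \<and> y \<otimes> x \<in> rad_pow R (Suc (Suc m))"
  proof induction
    case (prod u v)
    then have c: "u \<in> carrier R" "v \<in> carrier R" "y \<in> carrier R"
      using Suc.prems J.Icarr N.Icarr by auto
    have "(y \<otimes> u) \<otimes> v \<in> rad_pow R (Suc (Suc m))"
      by (rule rad_pow_Suc_mult) (use Suc prod in auto)
    then show ?case using c by (simp add: m_assoc)
  next
    case (sum u v)
    then show ?case using Suc.prems(1) J.Icarr N2.a_closed by (simp add: r_distr del: rad_pow.simps)
  qed
  then show ?case ..
qed

lemma idempotent_not_jacobson_radical:
  assumes nil: "rad_pow R n = {\<zero>}" and f: "f \<in> carrier R" "f \<otimes> f = f" "f \<noteq> \<zero>"
  shows "f \<notin> jacobson_radical R"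
proof
  assume "f \<in> jacobson_radical R"
  then have "f \<in> rad_pow R m" for m
  proof (induction m)
    case 0 then show ?case using f by simp
  next
    case (Suc m)
    then show ?case using rad_pow_Suc_mult[of f m f] f by simp
  qed
  then show False using nil f by auto
qed

end

section \<open>Strong regularity of finite-dimensional algebras\<close>

text \<open>Finite dimension enters the argument only through this condition, which is Fitting's lemma in
  elementwise form.\<close>

definition strongly_pi_regular :: "('a, 'r) ring_scheme \<Rightarrow> bool" where
  "strongly_pi_regular R \<longleftrightarrow> (\<forall>c\<in>carrier R. \<exists>z\<in>carrier R. \<exists>r.
     z \<otimes>\<^bsub>R\<^esub> c = c \<otimes>\<^bsub>R\<^esub> z \<and> c [^]\<^bsub>R\<^esub> (r::nat) = z \<otimes>\<^bsub>R\<^esub> c [^]\<^bsub>R\<^esub> Suc r)"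

text \<open>The base field embeds as a central subfield, so that the dimension theory of rings over an
  embedded subfield becomes applicable.\<close>

lemma fin_dim_algebra_central_subfield:
  fixes k :: "('k, 'r) ring_scheme" and A :: "('k, 'a) module"
  assumes A: "fin_dim_algebra k A" and nontriv: "\<one>\<^bsub>A\<^esub> \<noteq> \<zero>\<^bsub>A\<^esub>"
  defines "K \<equiv> (\<lambda>a. a \<odot>\<^bsub>A\<^esub> \<one>\<^bsub>A\<^esub>) ` carrier k"
  shows "subfield K A" "\<And>a x. \<lbrakk>a \<in> K; x \<in> carrier A\<rbrakk> \<Longrightarrow> a \<otimes>\<^bsub>A\<^esub> x = x \<otimes>\<^bsub>A\<^esub> a"
    "\<exists>Us. set Us \<subseteq> carrier A \<and> ring.Span A K Us = carrier A"
proof -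
  interpret k: field k using A by (simp add: fin_dim_algebra_def)
  interpret A: ring A using A by (simp add: fin_dim_algebra_def)
  interpret M: Module.module k A using A by (simp add: fin_dim_algebra_def)
  have l: "(a \<odot>\<^bsub>A\<^esub> x) \<otimes>\<^bsub>A\<^esub> y = a \<odot>\<^bsub>A\<^esub> (x \<otimes>\<^bsub>A\<^esub> y)"
    and r: "x \<otimes>\<^bsub>A\<^esub> (a \<odot>\<^bsub>A\<^esub> y) = a \<odot>\<^bsub>A\<^esub> (x \<otimes>\<^bsub>A\<^esub> y)"
    if "a \<in> carrier k" "x \<in> carrier A" "y \<in> carrier A" for a x y
    using A that by (simp_all add: fin_dim_algebra_def)
  let ?h = "\<lambda>a. a \<odot>\<^bsub>A\<^esub> \<one>\<^bsub>A\<^esub>"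
  have h: "ring_hom_ring k A ?h"
    by (rule ring_hom_ringI2)
      (auto intro!: ring_hom_memI k.ring_axioms A.ring_axioms
        simp: M.smult_l_distr l r M.smult_assoc1[symmetric] k.m_comm)
  show K: "subfield K A"
    unfolding K_def by (rule ring_hom_ring.img_is_subfield(2)[OF h k.carrier_is_subfield nontriv])
  show "a \<otimes>\<^bsub>A\<^esub> x = x \<otimes>\<^bsub>A\<^esub> a" if "a \<in> K" "x \<in> carrier A" for a x
    using that by (auto simp: K_def l r)
  obtain B where B: "finite B" "spanning k A B" using A by (auto simp: fin_dim_algebra_def)
  obtain Us where Us: "set Us = B" using finite_list[OF B(1)] by blast
  have UsA: "set Us \<subseteq> carrier A" using B Us by (simp add: spanning_def)
  note S = A.Span_subgroup_props[OF K UsA]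
  have "carrier A \<subseteq> A.Span K Us"
  proof
    fix x assume "x \<in> carrier A"
    then obtain c where c: "c \<in> B \<rightarrow> carrier k" "x = (\<Oplus>\<^bsub>A\<^esub>b\<in>B. c b \<odot>\<^bsub>A\<^esub> b)"
      using B(2) by (auto simp: spanning_def)
    have "(\<Oplus>\<^bsub>A\<^esub>b\<in>F. c b \<odot>\<^bsub>A\<^esub> b) \<in> A.Span K Us" if "finite F" "F \<subseteq> B" for F
      using that
    proof (induction F rule: finite_induct)
      case empty then show ?case using S(2) by (simp del: A.Span.simps)
    next
      case (insert b F)
      have cA: "c b \<odot>\<^bsub>A\<^esub> b \<in> carrier A" if "b \<in> insert b F \<union> B" "b \<in> B" for b
        using that insert.prems c(1) UsA Us by auto
      have "c b \<odot>\<^bsub>A\<^esub> b = ?h (c b) \<otimes>\<^bsub>A\<^esub> b"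
        using insert.prems c(1) UsA Us by (subst l) auto
      also have "\<dots> \<in> A.Span K Us"
        using insert.prems c(1) UsA Us A.Span_base_incl[OF K UsA]
        by (intro A.Span_smult_closed[OF K UsA]) (auto simp: K_def)
      finally have "c b \<odot>\<^bsub>A\<^esub> b \<in> A.Span K Us" .
      moreover have "(\<Oplus>\<^bsub>A\<^esub>b\<in>insert b F. c b \<odot>\<^bsub>A\<^esub> b)
          = c b \<odot>\<^bsub>A\<^esub> b \<oplus>\<^bsub>A\<^esub> (\<Oplus>\<^bsub>A\<^esub>b\<in>F. c b \<odot>\<^bsub>A\<^esub> b)"
        using insert cA by (intro A.finsum_insert) auto
      ultimately show ?case using insert S(3) by (simp del: A.Span.simps)
    qed
    then show "x \<in> A.Span K Us" using c B(1) by blast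
  qed
  then show "\<exists>Us. set Us \<subseteq> carrier A \<and> A.Span K Us = carrier A"
    using UsA S(1) by blast
qed

text \<open>Among more than \<open>dim A\<close> powers of \<open>c\<close> some \<open>c\<^sup>m\<close> is a linear combination of higher
  ones. Everything spanned by the powers above \<open>c\<^sup>m\<close> is a multiple of \<open>c\<^sup>m\<^sup>+\<^sup>1\<close> by an
  element commuting with \<open>c\<close>.\<close>

lemma fin_dim_algebra_strongly_pi_regular:
  fixes k :: "('k, 'r) ring_scheme" and A :: "('k, 'a) module"
  assumes A: "fin_dim_algebra k A"
  shows "strongly_pi_regular A"
  unfolding strongly_pi_regular_def
proof
  fix c assume c: "c \<in> carrier A"
  interpret A: ring A using A by (simp add: fin_dim_algebra_def)
  show "\<exists>z\<in>carrier A. \<exists>r. z \<otimes>\<^bsub>A\<^esub> c = c \<otimes>\<^bsub>A\<^esub> z \<and> c [^]\<^bsub>A\<^esub> (r::nat) = z \<otimes>\<^bsub>A\<^esub> c [^]\<^bsub>A\<^esub> Suc r"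
  proof (cases "\<one>\<^bsub>A\<^esub> = \<zero>\<^bsub>A\<^esub>")
    case True
    then have "carrier A = {\<zero>\<^bsub>A\<^esub>}" using A.one_zeroD by blast
    then show ?thesis using c by (intro bexI[of _ "\<zero>\<^bsub>A\<^esub>"] exI[of _ 0]) (auto simp: True)
  next
    case False
    define K where "K = (\<lambda>a. a \<odot>\<^bsub>A\<^esub> \<one>\<^bsub>A\<^esub>) ` carrier k"
    note K' = fin_dim_algebra_central_subfield[OF A False, folded K_def]
    note K = K'(1)
    have KA: "K \<subseteq> carrier A" using subfieldE(3)[OF K] .
    obtain Vs where Vs: "set Vs \<subseteq> carrier A" "A.independent K Vs" "A.Span K Vs = carrier A"
      using K'(3) A.filter_base[OF K] by metis
    define N where "N = Suc (length Vs)"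
    have "\<exists>m<N. c [^]\<^bsub>A\<^esub> m \<in> A.Span K (map (\<lambda>l. c [^]\<^bsub>A\<^esub> l) [Suc m..<N])"
    proof (rule ccontr)
      assume *: "\<not> ?thesis"
      \<comment> \<open>Otherwise the powers are independent; they are added one by one from the top.\<close>
      have "A.independent K (map (\<lambda>l. c [^]\<^bsub>A\<^esub> l) [N - d..<N])" if "d \<le> N" for d
        using that
      proof (induction d)
        case 0 then show ?case by simp
      next
        case (Suc d)
        then have "[N - Suc d..<N] = (N - Suc d) # [Suc (N - Suc d)..<N]" "Suc (N - Suc d) = N - d"
          by (auto simp: upt_rec)
        moreover have "c [^]\<^bsub>A\<^esub> (N - Suc d) \<notin> A.Span K (map (\<lambda>l. c [^]\<^bsub>A\<^esub> l) [Suc (N - Suc d)..<N])"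
          using * Suc.prems by (auto simp del: A.Span.simps)
        ultimately show ?case using Suc c by (auto intro!: A.li_Cons simp del: A.Span.simps)
      qed
      from this[of N] have "A.independent K (map (\<lambda>l. c [^]\<^bsub>A\<^esub> l) [0..<N])" by simp
      from A.independent_length_le[OF K this Vs(2)] show False
        using c by (auto simp: N_def Vs(3) simp del: A.Span.simps)
    qed
    then obtain m where m: "c [^]\<^bsub>A\<^esub> m \<in> A.Span K (map (\<lambda>l. c [^]\<^bsub>A\<^esub> l) [Suc m..<N])" by blast
    define E where "E = {z \<otimes>\<^bsub>A\<^esub> c [^]\<^bsub>A\<^esub> Suc m | z. z \<in> carrier A \<and> z \<otimes>\<^bsub>A\<^esub> c = c \<otimes>\<^bsub>A\<^esub> z}"
    have EI: "x \<in> E" if "z \<in> carrier A" "z \<otimes>\<^bsub>A\<^esub> c = c \<otimes>\<^bsub>A\<^esub> z" "x = z \<otimes>\<^bsub>A\<^esub> c [^]\<^bsub>A\<^esub> Suc m" for x z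
      using that by (auto simp: E_def)
    have E: "subgroup E (add_monoid A)"
    proof (rule A.add.subgroupI)
      show "E \<subseteq> carrier A" using c by (auto simp: E_def)
      show "E \<noteq> {}" using EI[of "\<zero>\<^bsub>A\<^esub>"] c by auto
    next
      fix x assume "x \<in> E"
      then obtain z where "z \<in> carrier A" "z \<otimes>\<^bsub>A\<^esub> c = c \<otimes>\<^bsub>A\<^esub> z" "x = z \<otimes>\<^bsub>A\<^esub> c [^]\<^bsub>A\<^esub> Suc m"
        by (auto simp: E_def)
      then show "\<ominus>\<^bsub>A\<^esub> x \<in> E" using c by (intro EI[of "\<ominus>\<^bsub>A\<^esub> z"]) (simp_all add: A.l_minus A.r_minus)
    next
      fix x y assume "x \<in> E" "y \<in> E"
      then obtain z w where "z \<in> carrier A" "z \<otimes>\<^bsub>A\<^esub> c = c \<otimes>\<^bsub>A\<^esub> z" "x = z \<otimes>\<^bsub>A\<^esub> c [^]\<^bsub>A\<^esub> Suc m"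
        "w \<in> carrier A" "w \<otimes>\<^bsub>A\<^esub> c = c \<otimes>\<^bsub>A\<^esub> w" "y = w \<otimes>\<^bsub>A\<^esub> c [^]\<^bsub>A\<^esub> Suc m"
        by (auto simp: E_def)
      then show "x \<oplus>\<^bsub>A\<^esub> y \<in> E" using c by (intro EI[of "z \<oplus>\<^bsub>A\<^esub> w"]) (simp_all add: A.l_distr A.r_distr)
    qed
    have "K <#>\<^bsub>A\<^esub> set (map (\<lambda>l. c [^]\<^bsub>A\<^esub> l) [Suc m..<N]) \<subseteq> E"
    proof
      fix x assume "x \<in> K <#>\<^bsub>A\<^esub> set (map (\<lambda>l. c [^]\<^bsub>A\<^esub> l) [Suc m..<N])"
      then obtain a l where al: "a \<in> K" "Suc m \<le> l" "x = a \<otimes>\<^bsub>A\<^esub> c [^]\<^bsub>A\<^esub> l"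
        by (auto simp: set_mult_def)
      then have aA: "a \<in> carrier A" using KA by auto
      have l: "c [^]\<^bsub>A\<^esub> l = c [^]\<^bsub>A\<^esub> (l - Suc m) \<otimes>\<^bsub>A\<^esub> c [^]\<^bsub>A\<^esub> Suc m"
        using A.nat_pow_mult[OF c, of "l - Suc m" "Suc m"] al by simp
      have "c [^]\<^bsub>A\<^esub> (l - Suc m) \<otimes>\<^bsub>A\<^esub> c = c \<otimes>\<^bsub>A\<^esub> c [^]\<^bsub>A\<^esub> (l - Suc m)"
        using A.nat_pow_Suc2[OF c, of "l - Suc m"] by simp
      then have "(a \<otimes>\<^bsub>A\<^esub> c [^]\<^bsub>A\<^esub> (l - Suc m)) \<otimes>\<^bsub>A\<^esub> c = (a \<otimes>\<^bsub>A\<^esub> c) \<otimes>\<^bsub>A\<^esub> c [^]\<^bsub>A\<^esub> (l - Suc m)"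
        using aA c by (simp add: A.m_assoc)
      also have "\<dots> = c \<otimes>\<^bsub>A\<^esub> (a \<otimes>\<^bsub>A\<^esub> c [^]\<^bsub>A\<^esub> (l - Suc m))"
        using aA c K'(2)[OF al(1) c] by (simp add: A.m_assoc)
      finally show "x \<in> E"
        using aA c al(3) unfolding l by (intro EI[of "a \<otimes>\<^bsub>A\<^esub> c [^]\<^bsub>A\<^esub> (l - Suc m)"]) (simp_all add: A.m_assoc)
    qed
    then have "A.Span K (map (\<lambda>l. c [^]\<^bsub>A\<^esub> l) [Suc m..<N]) \<subseteq> E"
      using c by (intro A.Span_min[OF K _ E]) auto
    then have "c [^]\<^bsub>A\<^esub> m \<in> E" using m by (auto simp del: A.Span.simps)
    then show ?thesis unfolding E_def by blast
  qed
qed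

context ring begin

text \<open>With \<open>w = z c\<close> the hypothesis gives \<open>w c\<^sup>r = c\<^sup>r\<close>, whence \<open>p = w\<^sup>r = z\<^sup>r c\<^sup>r\<close> is
  idempotent and fixes \<open>c\<^sup>r\<close>. If \<open>p = 0\<close> then \<open>c\<^sup>r = 0\<close>; if \<open>p = 1\<close> then
  \<open>w = w p = p = 1\<close>.\<close>

lemma unit_or_nilpotent:
  assumes c: "c \<in> carrier R" and z: "z \<in> carrier R" and comm: "z \<otimes> c = c \<otimes> z"
    and r: "c [^] r = z \<otimes> c [^] Suc r"
    and idem: "\<And>p. \<lbrakk>p \<in> carrier R; p \<otimes> p = p\<rbrakk> \<Longrightarrow> p = \<zero> \<or> p = \<one>"
  shows "c \<in> Units R \<or> c [^] (r::nat) = \<zero>"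
proof -
  define w where "w = z \<otimes> c"
  have wR: "w \<in> carrier R" using c z by (simp add: w_def)
  have wz: "w \<otimes> z = z \<otimes> w" using c z by (simp add: w_def m_assoc comm[symmetric])
  have step: "w \<otimes> c [^] r = c [^] r"
    using r c z nat_pow_Suc2[OF c, of r] by (simp add: w_def m_assoc)
  have wm: "w [^] m \<otimes> c [^] r = c [^] r" for m :: nat
    by (induction m) (use step wR c in \<open>simp_all add: m_assoc\<close>)
  define p where "p = z [^] r \<otimes> c [^] r"
  have p: "p = w [^] r" using pow_mult_distrib[OF comm z c] by (simp add: p_def w_def)
  have wzr: "w \<otimes> z [^] r = z [^] r \<otimes> w"
    using group_commutes_pow[of z w r] wz wR z by simp
  then have wrzr: "w [^] r \<otimes> z [^] r = z [^] r \<otimes> w [^] r"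
    using group_commutes_pow[of w "z [^] r" r] wR z by simp
  have pR: "p \<in> carrier R" using c z by (simp add: p_def)
  have "p \<otimes> p = (w [^] r \<otimes> z [^] r) \<otimes> c [^] r"
    using c z wR by (subst p, subst p_def) (simp add: m_assoc)
  also have "\<dots> = p" using c z wR wm[of r] by (simp add: wrzr m_assoc p_def)
  finally consider "p = \<zero>" | "p = \<one>" using idem[OF pR] by blast
  then show ?thesis
  proof cases
    case 1
    then have "c [^] r = \<zero>" using wm[of r] p c by simp
    then show ?thesis ..
  next
    case 2
    have "w = w \<otimes> (z [^] r \<otimes> c [^] r)" using 2 wR by (simp add: p_def)
    also have "\<dots> = z [^] r \<otimes> (w \<otimes> c [^] r)"
      using wzr wR c z by (simp add: m_assoc[symmetric])
    also have "\<dots> = \<one>" using 2 by (simp add: step p_def)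
    finally show ?thesis using comm c z by (auto simp: Units_def w_def)
  qed
qed

text \<open>The geometric series.\<close>

lemma one_minus_nilpotent:
  assumes c: "c \<in> carrier R" and nil: "c [^] (r::nat) = \<zero>"
  obtains s where "s \<in> carrier R" "s \<otimes> (\<one> \<ominus> c) = \<one>"
proof -
  have "\<exists>s\<in>carrier R. s \<otimes> (\<one> \<ominus> c) = \<one> \<ominus> c [^] m" for m :: nat
  proof (induction m)
    case 0 then show ?case using c by (intro bexI[of _ \<zero>]) (simp_all add: a_minus_def r_neg)
  next
    case (Suc m)
    then obtain s where s: "s \<in> carrier R" "s \<otimes> (\<one> \<ominus> c) = \<one> \<ominus> c [^] m" by blast
    have "(s \<oplus> c [^] m) \<otimes> (\<one> \<ominus> c) = (\<one> \<ominus> c [^] m) \<oplus> c [^] m \<otimes> (\<one> \<ominus> c)"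
      using s c by (simp add: l_distr)
    also have "\<dots> = \<one> \<ominus> c [^] Suc m"
      using c by (simp add: a_minus_def r_distr r_minus a_assoc r_neg1)
    finally show ?case using s c by (intro bexI[of _ "s \<oplus> c [^] m"]) simp_all
  qed
  from this[of r] show thesis using that by (auto simp: nil a_minus_def)
qed

end

section \<open>Corners of primitive idempotents\<close>

lemma corner_sel [simp]:
  "carrier (corner R f) = {f \<otimes>\<^bsub>R\<^esub> x \<otimes>\<^bsub>R\<^esub> f | x. x \<in> carrier R}"
  "one (corner R f) = f" "zero (corner R f) = zero R"
  "add (corner R f) = add R" "mult (corner R f) = mult R"
  by (simp_all add: corner_def)

context ring
begin

context
  fixes f
  assumes f: "f \<in> carrier R" and ff: "f \<otimes> f = f"
begin

lemma idem_left: "x \<in> carrier R \<Longrightarrow> f \<otimes> (f \<otimes> x) = f \<otimes> x"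
  using f by (simp add: m_assoc[symmetric] ff)

lemma corner_carrier_iff:
  "a \<in> carrier (corner R f) \<longleftrightarrow> a \<in> carrier R \<and> f \<otimes> a = a \<and> a \<otimes> f = a"
proof
  assume "a \<in> carrier (corner R f)"
  then show "a \<in> carrier R \<and> f \<otimes> a = a \<and> a \<otimes> f = a"
    using f by (auto simp: m_assoc idem_left ff)
next
  assume "a \<in> carrier R \<and> f \<otimes> a = a \<and> a \<otimes> f = a"
  then have "a = f \<otimes> a \<otimes> f" "a \<in> carrier R" by simp_all
  then show "a \<in> carrier (corner R f)" by auto
qed

lemma corner_ring: "ring (corner R f)"
proof -
  note [simp] = corner_carrier_iff and [simp del] = corner_sel(1)
  have "f \<otimes> (\<ominus> x) = \<ominus> x" "(\<ominus> x) \<otimes> f = \<ominus> x" "\<ominus> x \<oplus> x = \<zero>"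
    if "x \<in> carrier (corner R f)" for x
    using that f by (simp_all add: l_minus r_minus l_neg)
  then have neg: "\<exists>y\<in>carrier (corner R f). y \<oplus>\<^bsub>corner R f\<^esub> x = \<zero>\<^bsub>corner R f\<^esub>"
    if "x \<in> carrier (corner R f)" for x
    using that by (intro bexI[of _ "\<ominus> x"]) simp_all
  show ?thesis
  proof (rule ringI)
    show "abelian_group (corner R f)"
      using neg f by (auto intro!: abelian_groupI simp: a_ac l_distr r_distr)
    show "monoid (corner R f)"
      using f ff by (auto intro!: monoidI simp: m_assoc) (simp add: m_assoc[symmetric])
  qed (use f in \<open>simp_all add: l_distr r_distr\<close>)
qed

lemma corner_pow:
  assumes "c \<in> carrier (corner R f)"
  shows "c [^]\<^bsub>corner R f\<^esub> Suc m = c [^] Suc m"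
proof (induction m)
  case 0
  then show ?case using assms by (simp add: corner_carrier_iff del: corner_sel(1))
next
  case (Suc m)
  then show ?case by (simp only: Group.nat_pow_Suc corner_sel(5))
qed

end

text \<open>Primitivity of \<open>f\<close> says that \<open>fRf\<close> has no idempotents besides \<open>0\<close> and \<open>f\<close>. The
  element \<open>z\<close> witnessing strong regularity in \<open>R\<close> is moved into the corner as \<open>f z f\<close>; the
  exponent is raised by one because the zeroth powers in \<open>R\<close> and \<open>fRf\<close> differ.\<close>

lemma primitive_corner_unit_or_nilpotent:
  assumes pi: "strongly_pi_regular R" and prim: "primitive_idempotent R f"
    and c: "c \<in> carrier (corner R f)"
  shows "c \<in> Units (corner R f) \<or> (\<exists>r::nat. c [^]\<^bsub>corner R f\<^esub> r = \<zero>)"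
proof -
  have f: "f \<in> carrier R" "f \<otimes> f = f" using prim by (simp_all add: primitive_idempotent_def)
  interpret C: ring "corner R f" by (rule corner_ring[OF f])
  note iff = corner_carrier_iff[OF f]
  have cR: "c \<in> carrier R" "f \<otimes> c = c" "c \<otimes> f = c" using c iff by simp_all
  obtain z r where z: "z \<in> carrier R" "z \<otimes> c = c \<otimes> z" "c [^] (r::nat) = z \<otimes> c [^] Suc r"
    using pi cR(1) unfolding strongly_pi_regular_def by blast
  define z' where "z' = f \<otimes> z \<otimes> f"
  have z': "z' \<in> carrier (corner R f)" using z by (auto simp: z'_def)
  have fpow: "f \<otimes> c [^] Suc m = c [^] Suc m" for m
    unfolding nat_pow_Suc2[OF cR(1)] using cR f by (simp add: m_assoc[symmetric])
  have "z' \<otimes> c = f \<otimes> (z \<otimes> c)" using cR z f by (simp add: z'_def m_assoc)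
  also have "\<dots> = c \<otimes> z" using cR z f by (simp add: m_assoc[symmetric])
  also have "\<dots> = (z \<otimes> c) \<otimes> f" using m_assoc[OF z(1) cR(1) f(1)] cR(3) z(2) by metis
  also have "\<dots> = c \<otimes> z'" using cR z f by (simp add: z'_def m_assoc[symmetric])
  finally have comm: "z' \<otimes> c = c \<otimes> z'" .
  have "c [^] Suc r = (z \<otimes> c [^] Suc r) \<otimes> c" by (subst nat_pow_Suc, subst z(3)) (rule refl)
  then have "c [^] Suc r = z \<otimes> c [^] Suc (Suc r)"
    using m_assoc[OF z(1) nat_pow_closed[OF cR(1)] cR(1), of "Suc r"] by (simp only: nat_pow_Suc)
  then have "c [^] Suc r = f \<otimes> (z \<otimes> c [^] Suc (Suc r))" using fpow by metis
  also have "\<dots> = f \<otimes> (z \<otimes> (f \<otimes> c [^] Suc (Suc r)))" using fpow by metis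
  also have "\<dots> = z' \<otimes> c [^] Suc (Suc r)" using f z cR by (simp add: z'_def m_assoc del: nat_pow_Suc)
  finally have step: "c [^]\<^bsub>corner R f\<^esub> Suc r = z' \<otimes> c [^]\<^bsub>corner R f\<^esub> Suc (Suc r)"
    using corner_pow[OF f c] by metis
  have idem: "p = \<zero> \<or> p = f" if p: "p \<in> carrier (corner R f)" "p \<otimes> p = p" for p
  proof -
    have pR: "p \<in> carrier R" "f \<otimes> p = p" "p \<otimes> f = p" using p iff by simp_all
    have "f = p \<oplus> (f \<ominus> p)" using pR f by (simp add: a_minus_def a_ac r_neg1 r_neg2 r_neg)
    moreover have "(f \<ominus> p) \<otimes> (f \<ominus> p) = f \<ominus> p" "p \<otimes> (f \<ominus> p) = \<zero>" "(f \<ominus> p) \<otimes> p = \<zero>"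
      using pR f p by (simp_all add: a_minus_def l_distr r_distr l_minus r_minus r_neg l_neg)
    ultimately have "p = \<zero> \<or> f \<ominus> p = \<zero>"
      using prim pR p f unfolding primitive_idempotent_def by (meson minus_closed)
    then show ?thesis using pR f by auto
  qed
  have "c \<in> Units (corner R f) \<or> c [^]\<^bsub>corner R f\<^esub> Suc r = \<zero>\<^bsub>corner R f\<^esub>"
  proof (rule C.unit_or_nilpotent[OF c z'])
    show "z' \<otimes>\<^bsub>corner R f\<^esub> c = c \<otimes>\<^bsub>corner R f\<^esub> z'" using comm by simp
    show "c [^]\<^bsub>corner R f\<^esub> Suc r = z' \<otimes>\<^bsub>corner R f\<^esub> c [^]\<^bsub>corner R f\<^esub> Suc (Suc r)"
      using step by (simp only: corner_sel)
  qed (use idem in \<open>simp only: corner_sel\<close>)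
  then show ?thesis unfolding corner_sel(3) by blast
qed

text \<open>\<open>Rf\<close> is a local module: any of its elements outside the radical generates it. Some
  \<open>1 - y r\<close> is not left invertible. Then \<open>c = f y r\<close> is not nilpotent, for a left inverse of
  \<open>f - c\<close> in the corner would produce one of \<open>1 - y r\<close>; so \<open>c\<close> is a unit of the corner.\<close>

lemma generates_outside_radical:
  assumes pi: "strongly_pi_regular R" and prim: "primitive_idempotent R f"
    and r: "r \<in> carrier R" "r \<otimes> f = r" "r \<notin> jacobson_radical R"
  obtains y where "y \<in> carrier R" "f \<otimes> y = y" "y \<otimes> r = f"
proof -
  have f: "f \<in> carrier R" "f \<otimes> f = f" using prim by (simp_all add: primitive_idempotent_def)
  interpret C: ring "corner R f" by (rule corner_ring[OF f])
  note iff = corner_carrier_iff[OF f]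
  obtain y where y: "y \<in> carrier R" "\<And>x. x \<in> carrier R \<Longrightarrow> x \<otimes> (\<one> \<ominus> y \<otimes> r) \<noteq> \<one>"
    using not_jacobson_radicalE r by blast
  define b where "b = y \<otimes> r"
  have b: "b \<in> carrier R" "b \<otimes> f = b" using y r f by (simp_all add: b_def m_assoc)
  define c where "c = f \<otimes> b"
  have cC: "c \<in> carrier (corner R f)" using b f by (simp add: iff c_def m_assoc idem_left del: corner_sel(1))
  have "c [^]\<^bsub>corner R f\<^esub> m \<noteq> \<zero>" for m :: nat
  proof
    assume "c [^]\<^bsub>corner R f\<^esub> m = \<zero>"
    then obtain s where s: "s \<in> carrier (corner R f)" "s \<otimes> (f \<ominus>\<^bsub>corner R f\<^esub> c) = f"
      using C.one_minus_nilpotent[OF cC, of m] by auto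
    have sR: "s \<in> carrier R" "f \<otimes> s = s" "s \<otimes> f = s" using s iff by simp_all
    have cR: "c \<in> carrier R" using cC iff by simp
    have "\<ominus>\<^bsub>corner R f\<^esub> c = \<ominus> c"
    proof (rule C.minus_equality)
      show "\<ominus> c \<in> carrier (corner R f)" using cC f by (simp add: iff l_minus r_minus del: corner_sel(1))
    qed (use cC cR in \<open>simp_all add: l_neg\<close>)
    then have sc: "s \<otimes> (f \<ominus> c) = f" using s by (simp add: a_minus_def)
    have "s \<otimes> b = s \<otimes> c" using sR b f by (simp add: c_def m_assoc[symmetric])
    then have "s \<ominus> s \<otimes> b = f" using sc sR cR f by (simp add: a_minus_def r_distr r_minus)
    then have "b \<otimes> (s \<ominus> s \<otimes> b) = b" using b by simp
    then have bs: "b \<otimes> s \<ominus> b \<otimes> (s \<otimes> b) = b" using b sR by (simp add: a_minus_def r_distr r_minus)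
    \<comment> \<open>The passage between left inverses of \<open>1 - x y\<close> and \<open>1 - y x\<close>, for \<open>x = b\<close> and \<open>y = f\<close>.\<close>
    have "(\<one> \<oplus> b \<otimes> s) \<otimes> (\<one> \<ominus> b) = \<one> \<ominus> b \<oplus> (b \<otimes> s \<ominus> b \<otimes> (s \<otimes> b))"
      using b sR by (simp add: a_minus_def r_distr l_distr r_minus m_assoc a_ac minus_add)
    also have "\<dots> = \<one>" unfolding bs using b by (simp add: a_minus_def a_assoc l_neg)
    finally show False using y(2)[of "\<one> \<oplus> b \<otimes> s"] b sR by (simp add: b_def)
  qed
  then have "c \<in> Units (corner R f)"
    using primitive_corner_unit_or_nilpotent[OF pi prim cC] by blast
  then obtain d where d: "d \<in> carrier (corner R f)" "d \<otimes> c = f" by (auto simp: Units_def)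
  have dR: "d \<in> carrier R" "f \<otimes> d = d" "d \<otimes> f = d" using d iff by simp_all
  have "d \<otimes> f \<otimes> y \<otimes> r = d \<otimes> c" by (simp add: c_def b_def m_assoc dR(1) f(1) y(1) r(1))
  then show thesis using d dR y f by (intro that[of "d \<otimes> f \<otimes> y"]) (simp_all add: m_assoc[symmetric])
qed

text \<open>The radical of the corner is \<open>fRf \<inter> J\<close>, and outside it everything is invertible: by
  \<open>generates_outside_radical\<close> such an element is left invertible in \<open>R\<close>, hence not
  nilpotent.\<close>

lemma primitive_corner_unit:
  assumes pi: "strongly_pi_regular R" and prim: "primitive_idempotent R f"
    and a: "a \<in> carrier (corner R f)" "a \<notin> jacobson_radical R"
  shows "a \<in> Units (corner R f)"
proof -
  have f: "f \<in> carrier R" "f \<otimes> f = f" "f \<noteq> \<zero>" using prim by (simp_all add: primitive_idempotent_def)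
  interpret C: ring "corner R f" by (rule corner_ring[OF f(1,2)])
  note iff = corner_carrier_iff[OF f(1,2)]
  have aR: "a \<in> carrier R" "f \<otimes> a = a" "a \<otimes> f = a" using a iff by simp_all
  obtain y where y: "y \<in> carrier R" "y \<otimes> a = f"
    using generates_outside_radical[OF pi prim aR(1,3) a(2)] by blast
  have "a [^]\<^bsub>corner R f\<^esub> m \<noteq> \<zero>" for m :: nat
  proof (induction m)
    case 0 then show ?case using f by simp
  next
    case (Suc m)
    have am: "a [^]\<^bsub>corner R f\<^esub> m \<in> carrier R" "f \<otimes> a [^]\<^bsub>corner R f\<^esub> m = a [^]\<^bsub>corner R f\<^esub> m"
      using C.nat_pow_closed[OF a(1), of m] iff by simp_all
    have "y \<otimes> a [^]\<^bsub>corner R f\<^esub> Suc m = y \<otimes> a \<otimes> a [^]\<^bsub>corner R f\<^esub> m"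
      unfolding C.nat_pow_Suc2[OF a(1)] using y(1) aR am by (simp add: m_assoc)
    then have "y \<otimes> a [^]\<^bsub>corner R f\<^esub> Suc m = a [^]\<^bsub>corner R f\<^esub> m" using y am by simp
    then show ?case using Suc y by auto
  qed
  then show ?thesis using primitive_corner_unit_or_nilpotent[OF pi prim a(1)] by blast
qed

text \<open>An element \<open>r \<in> gRh\<close> outside the radical has some \<open>w \<in> hRg\<close> with \<open>w r = h\<close>. Then
  \<open>r w\<close> is a nonzero idempotent of \<open>gRg\<close>, hence equal to \<open>g\<close>, and multiplication by \<open>r\<close>
  and \<open>w\<close> are mutually inverse maps between \<open>Rg\<close> and \<open>Rh\<close>.\<close>

lemma off_diagonal_radical:
  assumes pi: "strongly_pi_regular R"
    and g: "primitive_idempotent R g" and h: "primitive_idempotent R h"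
    and niso: "\<not> module_isomorphic R (proj R g) (proj R h)"
    and r: "r \<in> carrier R" "g \<otimes> r = r" "r \<otimes> h = r"
  shows "r \<in> jacobson_radical R"
proof (rule ccontr)
  assume "r \<notin> jacobson_radical R"
  then obtain y where y: "y \<in> carrier R" "h \<otimes> y = y" "y \<otimes> r = h"
    using generates_outside_radical[OF pi h r(1,3)] by blast
  have gR: "g \<in> carrier R" "g \<otimes> g = g" using g by (simp_all add: primitive_idempotent_def)
  have hR: "h \<in> carrier R" "h \<otimes> h = h" "h \<noteq> \<zero>" using h by (simp_all add: primitive_idempotent_def)
  define w where "w = y \<otimes> g"
  have w: "w \<in> carrier R" "h \<otimes> w = w" "w \<otimes> g = w" "w \<otimes> r = h"
    using y gR hR r by (simp_all add: w_def m_assoc) (simp_all add: m_assoc[symmetric])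
  define p where "p = r \<otimes> w"
  have p: "p \<in> carrier R" "g \<otimes> p = p" "p \<otimes> g = p"
    using w r gR by (simp_all add: p_def m_assoc) (simp add: m_assoc[symmetric])
  have pp: "p \<otimes> p = p"
  proof -
    have "p \<otimes> p = r \<otimes> ((w \<otimes> r) \<otimes> w)" using w(1) r(1) by (simp add: p_def m_assoc)
    then show ?thesis using w by (simp add: p_def)
  qed
  have "w \<otimes> p = w" using w r by (simp add: p_def m_assoc[symmetric])
  then have "p \<noteq> \<zero>" using w hR r by auto
  have "g = p \<oplus> (g \<ominus> p)" using p gR by (simp add: a_minus_def a_ac r_neg1 r_neg2 r_neg)
  moreover have "(g \<ominus> p) \<otimes> (g \<ominus> p) = g \<ominus> p" "p \<otimes> (g \<ominus> p) = \<zero>" "(g \<ominus> p) \<otimes> p = \<zero>"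
    using p pp gR by (simp_all add: a_minus_def l_distr r_distr l_minus r_minus r_neg l_neg)
  ultimately have "p = \<zero> \<or> g \<ominus> p = \<zero>"
    using g p pp gR unfolding primitive_idempotent_def by (meson minus_closed)
  then have rw: "r \<otimes> w = g" using \<open>p \<noteq> \<zero>\<close> p gR by (auto simp: p_def)
  have "(\<lambda>x. x \<otimes> r) \<in> module_iso R (proj R g) (proj R h)"
  proof -
    have 1: "x \<otimes> r \<in> carrier (proj R h)" if "x \<in> carrier R" for x
      using that r hR by (auto simp: m_assoc intro!: exI[of _ "x \<otimes> r"])
    have "bij_betw (\<lambda>x. x \<otimes> r) (carrier (proj R g)) (carrier (proj R h))"
    proof (rule bij_betw_byWitness[where f' = "\<lambda>x. x \<otimes> w"])
      show "\<forall>x\<in>carrier (proj R g). x \<otimes> r \<otimes> w = x"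
        using r w gR by (auto simp: m_assoc rw)
      show "\<forall>x\<in>carrier (proj R h). x \<otimes> w \<otimes> r = x"
        using r w hR by (auto simp: m_assoc)
      show "(\<lambda>x. x \<otimes> r) ` carrier (proj R g) \<subseteq> carrier (proj R h)"
        using 1 gR by auto
      have "x \<otimes> w \<in> carrier (proj R g)" if "x \<in> carrier R" for x
        using that w gR by (auto simp: m_assoc intro!: exI[of _ "x \<otimes> w"])
      then show "(\<lambda>x. x \<otimes> w) ` carrier (proj R h) \<subseteq> carrier (proj R g)"
        using hR by auto
    qed
    then show ?thesis
      using 1 r gR by (auto simp: module_iso_def iso_def hom_def l_distr m_assoc simp del: proj_sel(1)) 
        (auto simp: l_distr m_assoc)
  qed
  then show False using niso by (auto simp: module_isomorphic_def)
qed

end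

section \<open>Truncation towers of cyclic modules\<close>

lemma module_epi_minus:
  assumes M: "left_module R M" and A: "left_module R A" and q: "q \<in> module_epi R M A"
    and x: "x \<in> carrier M" and y: "y \<in> carrier M"
  shows "q (x \<ominus>\<^bsub>M\<^esub> y) = q x \<ominus>\<^bsub>A\<^esub> q y"
proof -
  interpret M: left_module R M by fact
  interpret A: left_module R A by fact
  note qs = module_epiD[OF q]
  have "q (x \<ominus>\<^bsub>M\<^esub> y) \<oplus>\<^bsub>A\<^esub> q y = q ((x \<ominus>\<^bsub>M\<^esub> y) \<oplus>\<^bsub>M\<^esub> y)" using qs(3) x y by simp
  also have "(x \<ominus>\<^bsub>M\<^esub> y) \<oplus>\<^bsub>M\<^esub> y = x" using x y by (simp add: a_minus_def M.M.a_assoc M.M.l_neg)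
  finally have "q x = q (x \<ominus>\<^bsub>M\<^esub> y) \<oplus>\<^bsub>A\<^esub> q y" ..
  then show ?thesis
    using x y qs(1) by (simp add: a_minus_def A.M.a_assoc A.M.r_neg)
qed

lemma image_coset_eq_iff:
  assumes M: "left_module R M" and A: "left_module R A" and q: "q \<in> module_epi R M A"
    and S: "submodule S R M"
    and ker: "\<And>x y. \<lbrakk>x \<in> carrier M; y \<in> carrier M; q x = q y\<rbrakk> \<Longrightarrow> x \<ominus>\<^bsub>M\<^esub> y \<in> S"
    and x: "x \<in> carrier M" and y: "y \<in> carrier M"
  shows "(q ` S) +>\<^bsub>A\<^esub> q x = (q ` S) +>\<^bsub>A\<^esub> q y \<longleftrightarrow> x \<ominus>\<^bsub>M\<^esub> y \<in> S"
proof -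
  interpret M: left_module R M by fact
  interpret Q: quotient_module R A "q ` S"
    by (intro quotient_module.intro quotient_module_axioms.intro A submodule_image[OF M A q S])
  interpret S: abelian_subgroup S M by (rule M.submodule_abelian_subgroup[OF S])
  note qs = module_epiD[OF q]
  have "(q ` S) +>\<^bsub>A\<^esub> q x = (q ` S) +>\<^bsub>A\<^esub> q y \<longleftrightarrow> q (x \<ominus>\<^bsub>M\<^esub> y) \<in> q ` S"
    using Q.coset_eq_iff qs(1) x y module_epi_minus[OF M A q x y] by simp
  also have "\<dots> \<longleftrightarrow> x \<ominus>\<^bsub>M\<^esub> y \<in> S"
  proof
    assume "q (x \<ominus>\<^bsub>M\<^esub> y) \<in> q ` S"
    then obtain s where s: "s \<in> S" "q (x \<ominus>\<^bsub>M\<^esub> y) = q s" by blast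
    then have "(x \<ominus>\<^bsub>M\<^esub> y) \<ominus>\<^bsub>M\<^esub> s \<in> S" using ker x y by simp
    then have "((x \<ominus>\<^bsub>M\<^esub> y) \<ominus>\<^bsub>M\<^esub> s) \<oplus>\<^bsub>M\<^esub> s \<in> S" using s by simp
    moreover have "((x \<ominus>\<^bsub>M\<^esub> y) \<ominus>\<^bsub>M\<^esub> s) \<oplus>\<^bsub>M\<^esub> s = x \<ominus>\<^bsub>M\<^esub> y"
      using x y s by (simp add: a_minus_def M.M.a_assoc M.M.l_neg)
    ultimately show "x \<ominus>\<^bsub>M\<^esub> y \<in> S" by simp
  qed simp
  finally show ?thesis .
qed

lemma coset_absorb:
  assumes "abelian_group A" "additive_subgroup L A" "additive_subgroup L' A" "L' \<subseteq> L"
    and m: "m \<in> carrier A"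
  shows "L <+>\<^bsub>A\<^esub> (L' +>\<^bsub>A\<^esub> m) = L +>\<^bsub>A\<^esub> m"
proof -
  interpret A: abelian_group A by fact
  interpret L: additive_subgroup L A by fact
  interpret L': additive_subgroup L' A by fact
  show ?thesis
  proof
    show "L <+>\<^bsub>A\<^esub> (L' +>\<^bsub>A\<^esub> m) \<subseteq> L +>\<^bsub>A\<^esub> m"
    proof
      fix z assume "z \<in> L <+>\<^bsub>A\<^esub> (L' +>\<^bsub>A\<^esub> m)"
      then obtain l l' where l: "l \<in> L" "l' \<in> L'" "z = l \<oplus>\<^bsub>A\<^esub> (l' \<oplus>\<^bsub>A\<^esub> m)"
        by (auto simp: set_add_def' a_r_coset_def')
      then have "z = (l \<oplus>\<^bsub>A\<^esub> l') \<oplus>\<^bsub>A\<^esub> m" using m by (simp add: A.a_assoc)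
      moreover have "l \<oplus>\<^bsub>A\<^esub> l' \<in> L" using l assms by auto
      ultimately show "z \<in> L +>\<^bsub>A\<^esub> m" by (auto simp: a_r_coset_def')
    qed
    show "L +>\<^bsub>A\<^esub> m \<subseteq> L <+>\<^bsub>A\<^esub> (L' +>\<^bsub>A\<^esub> m)"
    proof
      fix z assume "z \<in> L +>\<^bsub>A\<^esub> m"
      then obtain l where "l \<in> L" "z = l \<oplus>\<^bsub>A\<^esub> (\<zero>\<^bsub>A\<^esub> \<oplus>\<^bsub>A\<^esub> m)"
        using m by (auto simp: a_r_coset_def')
      then show "z \<in> L <+>\<^bsub>A\<^esub> (L' +>\<^bsub>A\<^esub> m)"
        using L'.zero_closed unfolding set_add_def' a_r_coset_def' by blast
    qed
  qed
qed

context ring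
begin

lemma proj_carrier_iff:
  assumes "f \<in> carrier R" "f \<otimes> f = f"
  shows "x \<in> carrier (proj R f) \<longleftrightarrow> x \<in> carrier R \<and> x \<otimes> f = x"
  using assms by (auto simp: m_assoc intro: exI[of _ x])

lemma proj_minus:
  assumes "f \<in> carrier R" "x \<in> carrier (proj R f)" "y \<in> carrier (proj R f)"
  shows "x \<ominus>\<^bsub>proj R f\<^esub> y = x \<ominus> y"
proof -
  interpret P: left_module R "proj R f" by (rule left_module_proj[OF assms(1)])
  obtain u where u: "u \<in> carrier R" "y = u \<otimes> f" using assms(3) by auto
  have "\<ominus>\<^bsub>proj R f\<^esub> y = \<ominus> y"
  proof (rule P.M.minus_equality)
    show "\<ominus> y \<in> carrier (proj R f)"
      using u assms(1) by (auto simp: l_minus[symmetric] intro!: exI[of _ "\<ominus> u"])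
  qed (use u assms in \<open>simp_all add: l_neg\<close>)
  then show ?thesis by (simp add: a_minus_def)
qed

lemma ideal_proj_submodule:
  assumes f: "f \<in> carrier R" "f \<otimes> f = f" and I: "ideal I R"
  shows "submodule {x \<in> I. x \<otimes> f = x} R (proj R f)"
proof -
  interpret P: left_module R "proj R f" by (rule left_module_proj[OF f(1)])
  interpret I: ideal I R by fact
  show ?thesis
  proof (rule P.submoduleI)
    show "{x \<in> I. x \<otimes> f = x} \<subseteq> carrier (proj R f)"
      using proj_carrier_iff[OF f] I.Icarr by blast
  qed (use f in \<open>auto simp: l_distr m_assoc I.I_l_closed I.Icarr\<close>)
qed

text \<open>As \<open>A\<close> is cyclic, generated by \<open>q f\<close>, no sums are needed to describe \<open>I A\<close>.\<close>

lemma ideal_act_epi: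
  assumes f: "f \<in> carrier R" "f \<otimes> f = f" and I: "ideal I R"
    and A: "left_module R A" and q: "q \<in> module_epi R (proj R f) A"
  shows "ideal_act I A = q ` {x \<in> I. x \<otimes> f = x}"
proof
  interpret A: left_module R A by fact
  interpret I: ideal I R by fact
  note qs = module_epiD[OF q]
  note iff = proj_carrier_iff[OF f]
  let ?S = "{x \<in> I. x \<otimes> f = x}"
  have sub: "submodule (q ` ?S) R A"
    by (rule submodule_image[OF left_module_proj[OF f(1)] A q ideal_proj_submodule[OF f I]])
  have "{a \<odot>\<^bsub>A\<^esub> x | a x. a \<in> I \<and> x \<in> carrier A} \<subseteq> q ` ?S"
  proof
    fix w assume "w \<in> {a \<odot>\<^bsub>A\<^esub> x | a x. a \<in> I \<and> x \<in> carrier A}"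
    then obtain a x where ax: "a \<in> I" "x \<in> carrier A" "w = a \<odot>\<^bsub>A\<^esub> x" by blast
    then obtain y where y: "y \<in> carrier (proj R f)" "x = q y" using qs(2) by meson
    then have "w = q (a \<otimes> y)" using ax qs(4)[of a y] I.Icarr by simp
    moreover have "a \<otimes> y \<in> ?S" using y ax f unfolding iff
      by (simp add: I.I_r_closed I.Icarr m_assoc)
    ultimately show "w \<in> q ` ?S" by blast
  qed
  then show "ideal_act I A \<subseteq> q ` ?S"
    unfolding ideal_act_def
    by (rule A.M.add.generate_subgroup_incl) (use sub in \<open>simp add: submodule_def\<close>)
  show "q ` ?S \<subseteq> ideal_act I A"
  proof
    fix w assume "w \<in> q ` ?S"
    then obtain x where x: "x \<in> I" "x \<otimes> f = x" "w = q x" by blast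
    have fP: "f \<in> carrier (proj R f)" using f iff by simp
    have "w = x \<odot>\<^bsub>A\<^esub> q f" using qs(4)[OF _ fP, of x] x I.Icarr by simp
    then show "w \<in> ideal_act I A"
      unfolding ideal_act_def using x(1) qs(1)[OF fP] by (blast intro: generate.incl)
  qed
qed

lemma ideal_act_proj:
  assumes f: "f \<in> carrier R" "f \<otimes> f = f" and I: "ideal I R"
  shows "ideal_act I (proj R f) = {x \<in> I. x \<otimes> f = x}"
proof -
  have "id \<in> module_epi R (proj R f) (proj R f)" by (rule module_epiI) auto
  from ideal_act_epi[OF f I left_module_proj[OF f(1)] this] show ?thesis by simp
qed

text \<open>Because \<open>K \<subseteq> J\<^sup>n\<^sup>-\<^sup>1 \<subseteq> J\<^sup>d\<close>, the map from \<open>Rf\<close> onto the \<open>d\<close>-th truncation of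
  \<open>Rf/K\<close> identifies \<open>x\<close> and \<open>y\<close> exactly when \<open>x - y \<in> J\<^sup>d\<close>, a condition that does not
  mention \<open>K\<close>. These maps are compatible with the transitions, so the isomorphisms which they
  induce are compatible as well.\<close>

lemma same_tower_of_deep_submodules:
  assumes f: "f \<in> carrier R" "f \<otimes> f = f"
    and K: "submodule K R (proj R f)" "K \<subseteq> rad_pow R (n - 1)"
    and K': "submodule K' R (proj R f)" "K' \<subseteq> rad_pow R (n - 1)"
  shows "same_proper_tower R n (quot_module (proj R f) K) (quot_module (proj R f) K')"
proof -
  let ?P = "proj R f"
  \<comment> \<open>The canonical surjection of \<open>Rf\<close> onto the truncation in degree \<open>d\<close>.\<close>
  define p where "p K d x = ideal_act (rad_pow R d) (quot_module ?P K) +>\<^bsub>quot_module ?P K\<^esub> (K +>\<^bsub>?P\<^esub> x)"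
    for K d x
  have P: "left_module R ?P" by (rule left_module_proj[OF f(1)])
  then interpret P: left_module R ?P .
  have quot: "p K d \<in> module_epi R ?P (truncation R d (quot_module ?P K)) \<and>
      (\<forall>x\<in>carrier ?P. \<forall>y\<in>carrier ?P. p K d x = p K d y \<longleftrightarrow> x \<ominus> y \<in> rad_pow R d) \<and>
      (\<forall>x\<in>carrier ?P. transition R d (quot_module ?P K) (p K (Suc d) x) = p K d x)"
    if K: "submodule K R ?P" "K \<subseteq> rad_pow R (n - 1)" and d: "d < n" for K d
  proof -
    interpret K: quotient_module R ?P K using P K by (simp add: quotient_module_def quotient_module_axioms_def)
    let ?Q = "quot_module ?P K" and ?\<pi> = "\<lambda>x. K +>\<^bsub>?P\<^esub> x"
    let ?S = "\<lambda>d. {x \<in> rad_pow R d. x \<otimes> f = x}"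
    have Q: "left_module R ?Q" by (rule K.left_module_quot)
    then interpret Q: left_module R ?Q .
    have act: "ideal_act (rad_pow R d) ?Q = ?\<pi> ` ?S d" for d
      by (rule ideal_act_epi[OF f rad_pow_ideal Q K.coset_map_epi])
    have S: "submodule (?S d) R ?P" for d by (rule ideal_proj_submodule[OF f rad_pow_ideal])
    have L: "submodule (?\<pi> ` ?S d) R ?Q" for d
      by (rule submodule_image[OF P Q K.coset_map_epi S])
    interpret L: quotient_module R ?Q "?\<pi> ` ?S d"
      using Q L by (simp add: quotient_module_def quotient_module_axioms_def)
    have "K \<subseteq> ?S d"
    proof
      fix x assume x: "x \<in> K"
      then have "x \<in> carrier ?P" using K.N.a_subset by blast
      moreover have "x \<in> rad_pow R d" using x K(2) rad_pow_antimono[of d "n - 1"] d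
        by (metis Suc_diff_1 le_less_trans less_Suc_eq_le subsetD zero_le)
      ultimately show "x \<in> ?S d" using proj_carrier_iff[OF f] by blast
    qed
    then have ker: "x \<ominus>\<^bsub>?P\<^esub> y \<in> ?S d"
      if "x \<in> carrier ?P" "y \<in> carrier ?P" "?\<pi> x = ?\<pi> y" for x y
      using that K.coset_eq_iff by blast
    have fib: "p K d x = p K d y \<longleftrightarrow> x \<ominus> y \<in> rad_pow R d"
      if xy: "x \<in> carrier ?P" "y \<in> carrier ?P" for x y
    proof -
      have "p K d x = p K d y \<longleftrightarrow> x \<ominus>\<^bsub>?P\<^esub> y \<in> ?S d"
        unfolding p_def act by (rule image_coset_eq_iff[OF P Q K.coset_map_epi S ker xy])
      moreover have "x \<ominus>\<^bsub>?P\<^esub> y \<in> carrier ?P" using xy by (rule P.M.minus_closed)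
      ultimately show ?thesis
        using proj_carrier_iff[OF f] proj_minus[OF f(1) xy] by auto
    qed
    have "p K d = (\<lambda>X. (?\<pi> ` ?S d) +>\<^bsub>?Q\<^esub> X) \<circ> ?\<pi>" by (simp add: fun_eq_iff p_def act)
    moreover have "\<dots> \<in> module_epi R ?P (quot_module ?Q (?\<pi> ` ?S d))"
      by (rule module_epi_comp[OF K.coset_map_epi L.coset_map_epi])
    ultimately have epi: "p K d \<in> module_epi R ?P (truncation R d ?Q)"
      unfolding truncation_def act by simp
    have add: "additive_subgroup (?\<pi> ` ?S d) ?Q" for d
      using L[of d] by (simp add: additive_subgroup_def submodule_def)
    have "transition R d ?Q (p K (Suc d) x) = p K d x" if "x \<in> carrier ?P" for x
      unfolding transition_def p_def act
    proof (rule coset_absorb)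
      show "additive_subgroup (?\<pi> ` ?S d) ?Q" "additive_subgroup (?\<pi> ` ?S (Suc d)) ?Q" by (rule add)+
      show "?\<pi> ` ?S (Suc d) \<subseteq> ?\<pi> ` ?S d" using rad_pow_Suc_subset[of d] by blast
      show "?\<pi> x \<in> carrier ?Q" by (rule K.quot_carrierI[OF that])
    qed (rule Q.M.abelian_group_axioms)
    with epi fib show ?thesis by blast
  qed
  note Kq = quot[OF K] and Kq' = quot[OF K']
  have "\<exists>\<phi>. \<phi> \<in> module_iso R (truncation R d (quot_module ?P K)) (truncation R d (quot_module ?P K'))
      \<and> (\<forall>x\<in>carrier ?P. \<phi> (p K d x) = p K' d x)" if d: "d < n" for d
  proof -
    have "p K d x = p K d y \<longleftrightarrow> p K' d x = p K' d y" if "x \<in> carrier ?P" "y \<in> carrier ?P" for x y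
      using Kq[OF d] Kq'[OF d] that by blast
    then show ?thesis
      using induced_module_iso[OF P conjunct1[OF Kq[OF d]] conjunct1[OF Kq'[OF d]]] by metis
  qed
  then obtain \<phi> where
    \<phi>: "\<And>d. d < n \<Longrightarrow> \<phi> d \<in> module_iso R (truncation R d (quot_module ?P K)) (truncation R d (quot_module ?P K'))"
      "\<And>d x. \<lbrakk>d < n; x \<in> carrier ?P\<rbrakk> \<Longrightarrow> \<phi> d (p K d x) = p K' d x"
    by metis
  show ?thesis
    unfolding same_proper_tower_def
  proof (intro exI[of _ \<phi>] conjI allI impI ballI)
    fix d X assume d: "1 \<le> d \<and> Suc d < n" and X: "X \<in> carrier (truncation R (Suc d) (quot_module ?P K))"
    then have d': "d < n" "Suc d < n" by simp_all
    obtain x where x: "x \<in> carrier ?P" "X = p K (Suc d) x"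
      using module_epiD(2)[OF conjunct1[OF Kq[OF d'(2)]] X] by blast
    show "transition R d (quot_module ?P K') (\<phi> (Suc d) X) = \<phi> d (transition R d (quot_module ?P K) X)"
      using x \<phi>(2) d' Kq[OF d'(1)] Kq'[OF d'(1)] by simp
  qed (use \<phi>(1) in simp)
qed

end

section \<open>Terminal completions\<close>

lemma a_r_coset_corner [simp]: "a_r_coset (corner R f) = a_r_coset R"
  by (simp add: fun_eq_iff a_r_coset_def')

lemma V_space_sel [simp]:
  "carrier (V_space R n f g) = {g \<otimes>\<^bsub>R\<^esub> x \<otimes>\<^bsub>R\<^esub> f | x. x \<in> rad_pow R (n - 1)}"
  "zero (V_space R n f g) = zero R" "add (V_space R n f g) = add R"
  "smult (V_space R n f g) = left_act R"
  by (simp_all add: V_space_def mk_module_def)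

text \<open>The zero space has only the empty basis, as a scalar \<open>1 \<noteq> 0\<close> kills the zero vector.\<close>

lemma vdim_trivial:
  assumes Q: "abelian_group Q" and triv: "carrier Q = {\<zero>\<^bsub>Q\<^esub>}"
    and one: "\<one>\<^bsub>D\<^esub> \<in> carrier D" "\<one>\<^bsub>D\<^esub> \<noteq> \<zero>\<^bsub>D\<^esub>" "\<one>\<^bsub>D\<^esub> \<odot>\<^bsub>Q\<^esub> \<zero>\<^bsub>Q\<^esub> = \<zero>\<^bsub>Q\<^esub>"
  shows "vdim D Q = 0"
proof -
  interpret Q: abelian_group Q by fact
  have "B = {}" if "finite_basis D Q B" for B
  proof (rule ccontr)
    assume "B \<noteq> {}"
    then have B: "B = {\<zero>\<^bsub>Q\<^esub>}" and ind: "Defs.independent D Q B"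
      using that triv by (auto simp: finite_basis_def Defs.independent_def)
    have "(\<Oplus>\<^bsub>Q\<^esub>b\<in>B. \<one>\<^bsub>D\<^esub> \<odot>\<^bsub>Q\<^esub> b) = \<zero>\<^bsub>Q\<^esub>" by (simp add: B one)
    moreover have "(\<lambda>_. \<one>\<^bsub>D\<^esub>) \<in> B \<rightarrow> carrier D" using one by simp
    ultimately have "\<forall>b\<in>B. \<one>\<^bsub>D\<^esub> = \<zero>\<^bsub>D\<^esub>"
      using ind[unfolded Defs.independent_def, THEN conjunct2, THEN bspec, of "\<lambda>_. \<one>\<^bsub>D\<^esub>"] by simp
    then show False using one B by simp
  qed
  then have "(SOME B. finite_basis D Q B) = {}" if "\<exists>B. finite_basis D Q B"
    using someI_ex[OF that] by blast
  then show ?thesis by (simp add: vdim_def)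
qed

locale nilpotent_basic_algebra = ring R for R (structure) +
  fixes n t i j :: nat and e :: "nat \<Rightarrow> 'a"
  assumes pi_regular: "strongly_pi_regular R"
    and n: "n \<ge> 1" and nilpotent: "rad_pow R n = {\<zero>}"
    and idempotents: "complete_primitive_orthogonal R t e"
    and basic: "basic_wrt R t e"
    and i: "i \<in> {1..t}" and j: "j \<in> {1..t}"
begin

abbreviation f where "f \<equiv> e i"
abbreviation g where "g \<equiv> e j"
abbreviation J where "J \<equiv> jacobson_radical R"
abbreviation N where "N \<equiv> rad_pow R (n - 1)"
abbreviation P where "P \<equiv> proj R f"
abbreviation I where "I \<equiv> {f \<otimes> x \<otimes> f | x. x \<in> J}"
abbreviation K where "K \<equiv> K_sub R n t e i j"
abbreviation V where "V \<equiv> V_space R n f g"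

declare One_nat_def [simp del] proj_sel(1) [simp del] corner_sel(1) [simp del] V_space_sel(1) [simp del]

sublocale J: ideal J R by (rule jacobson_radical_ideal)
sublocale N: ideal N R by (rule rad_pow_ideal)

lemma primitive: "h \<in> {1..t} \<Longrightarrow> primitive_idempotent R (e h)"
  using idempotents unfolding complete_primitive_orthogonal_def by blast

lemma e_idem: "h \<in> {1..t} \<Longrightarrow> e h \<in> carrier R" "h \<in> {1..t} \<Longrightarrow> e h \<otimes> e h = e h"
  using primitive by (simp_all add: primitive_idempotent_def)

lemma f: "f \<in> carrier R" "f \<otimes> f = f" and g: "g \<in> carrier R" "g \<otimes> g = g"
  using e_idem i j by simp_all

lemma e_orth: "\<lbrakk>h \<in> {1..t}; h' \<in> {1..t}; h \<noteq> h'\<rbrakk> \<Longrightarrow> e h \<otimes> e h' = \<zero>"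
  using idempotents by (simp add: complete_primitive_orthogonal_def)

lemma e_not_J: "h \<in> {1..t} \<Longrightarrow> e h \<notin> J"
  using idempotent_not_jacobson_radical[OF nilpotent] primitive[of h]
  by (simp add: primitive_idempotent_def)

lemma NJ: "\<lbrakk>x \<in> N; y \<in> J\<rbrakk> \<Longrightarrow> x \<otimes> y = \<zero>"
  using rad_pow_Suc_mult[of x "n - 1" y] n nilpotent by simp

lemma JN: "\<lbrakk>y \<in> J; x \<in> N\<rbrakk> \<Longrightarrow> y \<otimes> x = \<zero>"
  using rad_pow_Suc_mult'[of y x "n - 1"] n nilpotent by simp

lemma P_iff: "x \<in> carrier P \<longleftrightarrow> x \<in> carrier R \<and> x \<otimes> f = x"
  by (rule proj_carrier_iff[OF f])

lemma V_iff: "v \<in> carrier V \<longleftrightarrow> v \<in> N \<and> g \<otimes> v = v \<and> v \<otimes> f = v"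
proof
  assume "v \<in> carrier V"
  then obtain x where x: "x \<in> N" "v = g \<otimes> x \<otimes> f" unfolding V_space_sel(1) by blast
  then show "v \<in> N \<and> g \<otimes> v = v \<and> v \<otimes> f = v"
    using f g idem_left[OF g] by (simp add: m_assoc N.I_l_closed N.I_r_closed)
next
  assume "v \<in> N \<and> g \<otimes> v = v \<and> v \<otimes> f = v"
  then have "v = g \<otimes> v \<otimes> f" "v \<in> N" by simp_all
  then show "v \<in> carrier V" unfolding V_space_sel(1) by blast
qed

text \<open>The consequence of basicness that makes \<open>K\<^sub>U\<close> a submodule.\<close>

lemma off_diagonal_annihilates:
  assumes r: "r \<in> carrier R" and h: "h \<in> {1..t}" "h \<noteq> j" and x: "x \<in> N"
  shows "g \<otimes> r \<otimes> e h \<otimes> x = \<zero>"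
proof -
  have "g \<otimes> r \<otimes> e h \<in> J"
  proof (rule off_diagonal_radical[OF pi_regular primitive[OF j] primitive[OF h(1)]])
    show "\<not> module_isomorphic R (proj R g) (proj R (e h))"
      using basic j h by (simp add: basic_wrt_def)
  qed (use r g e_idem[OF h(1)] in \<open>simp_all add: m_assoc idem_left[OF g]\<close>)
  then show ?thesis by (rule JN[OF _ x])
qed

lemma decomposition:
  assumes x: "x \<in> carrier R"
  shows "x = g \<otimes> x \<oplus> (\<Oplus>h\<in>{1..t} - {j}. e h \<otimes> x)"
proof -
  have e: "e \<in> {1..t} \<rightarrow> carrier R" using e_idem by auto
  have "x = (\<Oplus>h\<in>{1..t}. e h) \<otimes> x"
    using idempotents x by (simp add: complete_primitive_orthogonal_def)
  also have "\<dots> = (\<Oplus>h\<in>{1..t}. e h \<otimes> x)" by (rule finsum_ldistr[OF _ x e]) simp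
  also have "{1..t} = insert j ({1..t} - {j})" using j by auto
  also have "(\<Oplus>h\<in>insert j ({1..t} - {j}). e h \<otimes> x) = g \<otimes> x \<oplus> (\<Oplus>h\<in>{1..t} - {j}. e h \<otimes> x)"
    by (rule finsum_insert) (use x e_idem g in auto)
  finally show ?thesis .
qed

text \<open>The complement \<open>W\<^sub>j\<close> of \<open>V\<close> in \<open>N f\<close> is stable under \<open>R\<close>: expand \<open>x\<close> along
  the remaining idempotents and apply \<open>off_diagonal_annihilates\<close> to each term.\<close>

lemma g_annihilates:
  assumes r: "r \<in> carrier R" and x: "x \<in> N" "g \<otimes> x = \<zero>"
  shows "g \<otimes> (r \<otimes> x) = \<zero>"
proof -
  have xR: "x \<in> carrier R" using x by (simp add: N.Icarr)
  have ex: "(\<lambda>h. e h \<otimes> x) \<in> {1..t} - {j} \<rightarrow> carrier R" using e_idem xR by auto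
  have "x = (\<Oplus>h\<in>{1..t} - {j}. e h \<otimes> x)" using decomposition[OF xR] x ex by simp
  then have "(g \<otimes> r) \<otimes> x = (g \<otimes> r) \<otimes> (\<Oplus>h\<in>{1..t} - {j}. e h \<otimes> x)" by (rule arg_cong)
  also have "\<dots> = (\<Oplus>h\<in>{1..t} - {j}. (g \<otimes> r) \<otimes> (e h \<otimes> x))"
    by (rule finsum_rdistr[OF _ _ ex]) (use g r in simp_all)
  also have "\<dots> = \<zero>"
  proof (rule add.finprod_one_eqI)
    fix h assume h: "h \<in> {1..t} - {j}"
    then show "(g \<otimes> r) \<otimes> (e h \<otimes> x) = \<zero>"
      using off_diagonal_annihilates[OF r _ _ x(1), of h] e_idem(1)[of h] g r xR by (simp add: m_assoc)
  qed
  finally show ?thesis using g r xR by (simp add: m_assoc)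
qed

lemma W_part_eq: "W_part R n t e i j = {x \<in> N. x \<otimes> f = x \<and> g \<otimes> x = \<zero>}" (is "?W = ?S")
proof
  have act: "ideal_act N P = {x \<in> N. x \<otimes> f = x}" by (rule ideal_act_proj[OF f N.is_ideal])
  show "?W \<subseteq> ?S"
  proof
    fix x assume "x \<in> ?W"
    then obtain w where w: "x = (\<Oplus>h\<in>{1..t} - {j}. w h)"
      "\<And>h. h \<in> {1..t} - {j} \<Longrightarrow> w h \<in> {e h \<otimes> y | y. y \<in> ideal_act N P}"
      unfolding W_part_def by blast
    have wS: "w h \<in> ?S" if h: "h \<in> {1..t} - {j}" for h
    proof -
      obtain y where y: "y \<in> N" "y \<otimes> f = y" "w h = e h \<otimes> y" using w(2)[OF h] act by auto
      then have "g \<otimes> w h = g \<otimes> e h \<otimes> y" using e_idem h g N.Icarr by (simp add: m_assoc)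
      also have "g \<otimes> e h = \<zero>" using e_orth[of j h] j h by auto
      finally show ?thesis using y e_idem h f N.Icarr by (simp add: m_assoc N.I_l_closed)
    qed
    have "(\<Oplus>h\<in>F. w h) \<in> ?S" if "finite F" "F \<subseteq> {1..t} - {j}" for F
      using that
    proof (induction F rule: finite_induct)
      case empty
      then show ?case using f g by simp
    next
      case (insert h F)
      have "w h' \<in> carrier R" if "h' \<in> insert h F" for h'
        using insert.prems wS N.Icarr that by blast
      then have wR: "w \<in> F \<rightarrow> carrier R" "w h \<in> carrier R" by simp_all
      have "w h \<in> ?S" using wS insert.prems by blast
      then show ?case using insert wR f g by (simp add: l_distr r_distr)
    qed
    from this[of "{1..t} - {j}"] show "x \<in> ?S" by (simp add: w(1)[symmetric])
  qed
  show "?S \<subseteq> ?W"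
  proof
    fix x assume x: "x \<in> ?S"
    have "(\<lambda>h. e h \<otimes> x) \<in> {1..t} - {j} \<rightarrow> carrier R" using e_idem x N.Icarr by auto
    then have "x = (\<Oplus>h\<in>{1..t} - {j}. e h \<otimes> x)" using decomposition[of x] x N.Icarr by simp
    then show "x \<in> ?W" unfolding W_part_def act using x by blast
  qed
qed

text \<open>The \<open>D\<^sub>j\<close>-subspaces of \<open>V\<close>, with \<open>D\<^sub>j\<close> acting through representatives
  \<open>g r g\<close>; as \<open>g u = u\<close> on \<open>V\<close>, the right-hand \<open>g\<close> is absorbed.\<close>

definition subspace :: "'a set \<Rightarrow> bool" where
  "subspace U \<longleftrightarrow> U \<subseteq> carrier V \<and> \<zero> \<in> U \<and> (\<forall>u\<in>U. \<forall>v\<in>U. u \<oplus> v \<in> U) \<and>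
     (\<forall>r\<in>carrier R. \<forall>u\<in>U. g \<otimes> (r \<otimes> u) \<in> U)"

lemma K_eq:
  assumes U: "subspace U"
  shows "K U = {x \<in> N. x \<otimes> f = x \<and> g \<otimes> x \<in> U}"
proof
  have UV: "u \<in> N" "g \<otimes> u = u" "u \<otimes> f = u" "u \<in> carrier R" if "u \<in> U" for u
    using U that V_iff N.Icarr unfolding subspace_def by blast+
  show "K U \<subseteq> {x \<in> N. x \<otimes> f = x \<and> g \<otimes> x \<in> U}"
  proof
    fix x assume "x \<in> K U"
    then obtain w u where "w \<in> N" "w \<otimes> f = w" "g \<otimes> w = \<zero>" "u \<in> U" "x = w \<oplus> u"
      unfolding K_sub_def W_part_eq set_add_def' by blast
    then show "x \<in> {x \<in> N. x \<otimes> f = x \<and> g \<otimes> x \<in> U}"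
      using UV[OF \<open>u \<in> U\<close>] f g N.Icarr by (simp add: l_distr r_distr)
  qed
  show "{x \<in> N. x \<otimes> f = x \<and> g \<otimes> x \<in> U} \<subseteq> K U"
  proof
    fix x assume "x \<in> {x \<in> N. x \<otimes> f = x \<and> g \<otimes> x \<in> U}"
    then have x: "x \<in> N" "x \<otimes> f = x" "g \<otimes> x \<in> U" "x \<in> carrier R" by (simp_all add: N.Icarr)
    let ?w = "x \<ominus> g \<otimes> x"
    have "?w \<in> W_part R n t e i j"
      unfolding W_part_eq using x f g
      by (simp add: a_minus_def l_distr r_distr l_minus r_minus m_assoc idem_left[OF g] r_neg N.I_l_closed)
    moreover have "x = ?w \<oplus> g \<otimes> x" using x g by (simp add: a_minus_def a_assoc l_neg)
    ultimately show "x \<in> K U" unfolding K_sub_def set_add_def' using x(3) by blast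
  qed
qed

lemma K_submodule:
  assumes U: "subspace U"
  shows "submodule (K U) R P"
proof -
  interpret P: left_module R P by (rule left_module_proj[OF f(1)])
  note U' = U[unfolded subspace_def]
  have smult: "a \<otimes> x \<in> K U" if a: "a \<in> carrier R" and "x \<in> K U" for a x
  proof -
    have x: "x \<in> N" "x \<otimes> f = x" "g \<otimes> x \<in> U" "x \<in> carrier R"
      using that K_eq[OF U] N.Icarr by auto
    \<comment> \<open>Split \<open>x\<close> into its \<open>W\<^sub>j\<close>-component and its component in \<open>U\<close>.\<close>
    let ?w = "x \<ominus> g \<otimes> x"
    have "g \<otimes> (a \<otimes> ?w) = \<zero>"
      by (rule g_annihilates) (use x a g in \<open>simp_all add: a_minus_def r_distr r_minus idem_left[OF g] r_neg N.I_l_closed\<close>)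
    then have "g \<otimes> (a \<otimes> ?w) \<oplus> g \<otimes> (a \<otimes> (g \<otimes> x)) = g \<otimes> (a \<otimes> (g \<otimes> x))"
      using x a g by simp
    moreover have "g \<otimes> (a \<otimes> ?w) \<oplus> g \<otimes> (a \<otimes> (g \<otimes> x)) = g \<otimes> (a \<otimes> (?w \<oplus> g \<otimes> x))"
      using x a g by (simp add: r_distr)
    moreover have "?w \<oplus> g \<otimes> x = x" using x g by (simp add: a_minus_def a_assoc l_neg)
    moreover have "g \<otimes> (a \<otimes> (g \<otimes> x)) \<in> U" using U' a x by blast
    ultimately have "g \<otimes> (a \<otimes> x) \<in> U" by simp
    then show ?thesis unfolding K_eq[OF U] using x a f by (simp add: N.I_l_closed m_assoc)
  qed
  show ?thesis
  proof (rule P.submoduleI)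
    show "K U \<subseteq> carrier P" using K_eq[OF U] P_iff N.Icarr by blast
    show "\<zero>\<^bsub>P\<^esub> \<in> K U" using U' f g by (simp add: K_eq[OF U])
    show "x \<oplus>\<^bsub>P\<^esub> y \<in> K U" if "x \<in> K U" "y \<in> K U" for x y
      using that U' f g N.Icarr by (auto simp: K_eq[OF U] l_distr r_distr)
  qed (use smult in simp)
qed

lemma K_quotient: "subspace U \<Longrightarrow> quotient_module R P (K U)"
  using left_module_proj[OF f(1)] K_submodule
  by (simp add: quotient_module_def quotient_module_axioms_def)

lemma subspace_minus:
  assumes U: "subspace U" and u: "u \<in> U" shows "\<ominus> u \<in> U"
proof -
  have uV: "u \<in> carrier R" "g \<otimes> u = u"
    using U u V_iff N.Icarr unfolding subspace_def by blast+
  have "g \<otimes> ((\<ominus> \<one>) \<otimes> u) \<in> U" using U u unfolding subspace_def by blast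
  then show ?thesis using uV g by (simp add: l_minus r_minus)
qed

text \<open>The image of the generator \<open>f\<close> determines an isomorphism, so lifting it to \<open>b \<in> P\<close> lifts the
  whole map to right multiplication by \<open>a = f b\<close>. Surjectivity of \<open>\<phi>\<close> together
  with \<open>U' \<noteq> V\<close> keeps \<open>a\<close> outside the radical, which makes it a unit.\<close>

lemma iso_imp_translate:
  assumes U: "subspace U" and U': "subspace U'" "U' \<noteq> carrier V"
    and \<phi>: "\<phi> \<in> module_iso R (quot_module P (K U)) (quot_module P (K U'))"
  obtains a where "a \<in> Units (corner R f)" "(\<lambda>u. u \<otimes> a) ` U = U'"
proof -
  interpret Q: quotient_module R P "K U" by (rule K_quotient[OF U])
  interpret Q': quotient_module R P "K U'" by (rule K_quotient[OF U'(1)])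
  interpret C: ring "corner R f" by (rule corner_ring[OF f])
  note \<phi>s = module_isoD[OF \<phi>]
  let ?\<pi> = "\<lambda>x. K U +>\<^bsub>P\<^esub> x" and ?\<pi>' = "\<lambda>x. K U' +>\<^bsub>P\<^esub> x"
  note ps = module_epiD[OF Q.coset_map_epi] and ps' = module_epiD[OF Q'.coset_map_epi]
  have fP: "f \<in> carrier P" using f P_iff by simp
  obtain b where b: "b \<in> carrier P" "\<phi> (?\<pi> f) = ?\<pi>' b"
    using ps'(2) \<phi>s(1)[OF ps(1)[OF fP]] by meson
  define a where "a = f \<otimes> b"
  have bR: "b \<in> carrier R" "b \<otimes> f = b" using b(1) P_iff by simp_all
  have a: "a \<in> carrier (corner R f)"
    unfolding corner_carrier_iff[OF f] using bR f by (simp add: a_def m_assoc idem_left[OF f])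
  have aR: "a \<in> carrier R" "f \<otimes> a = a" "a \<otimes> f = a" using a corner_carrier_iff[OF f] by simp_all
  have key: "\<phi> (?\<pi> x) = ?\<pi>' (x \<otimes> a)" if x: "x \<in> carrier P" for x
  proof -
    have xR: "x \<in> carrier R" "x \<otimes> f = x" using x P_iff by simp_all
    have "?\<pi> x = x \<odot>\<^bsub>quot_module P (K U)\<^esub> ?\<pi> f" using ps(4)[OF xR(1) fP] xR by simp
    then have "\<phi> (?\<pi> x) = x \<odot>\<^bsub>quot_module P (K U')\<^esub> ?\<pi>' b"
      using \<phi>s(4)[OF xR(1) ps(1)[OF fP]] b by simp
    also have "\<dots> = ?\<pi>' (x \<otimes> b)" using ps'(4)[OF xR(1) b(1)] by simp
    also have "x \<otimes> b = x \<otimes> a" using xR bR f by (simp add: a_def m_assoc[symmetric])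
    finally show ?thesis .
  qed
  have xaP: "x \<otimes> a \<in> carrier P" if "x \<in> carrier R" for x using that aR f P_iff by (simp add: m_assoc)
  have kernel: "x \<in> K U \<longleftrightarrow> x \<otimes> a \<in> K U'" if x: "x \<in> carrier P" for x
  proof -
    have xR: "x \<in> carrier R" using x P_iff by simp
    have z: "\<zero> \<in> carrier P" using P_iff f by simp
    have "x \<in> K U \<longleftrightarrow> ?\<pi> x = ?\<pi> \<zero>"
      using Q.coset_eq_iff[OF x z] proj_minus[OF f(1) x z] xR by (simp add: a_minus_def)
    also have "\<dots> \<longleftrightarrow> \<phi> (?\<pi> x) = \<phi> (?\<pi> \<zero>)"
      using inj_on_eq_iff[OF bij_betw_imp_inj_on[OF \<phi>s(2)] ps(1)[OF x] ps(1)[OF z]] by simp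
    also have "\<dots> \<longleftrightarrow> ?\<pi>' (x \<otimes> a) = ?\<pi>' \<zero>" using key[OF x] key[OF z] aR by simp
    also have "\<dots> \<longleftrightarrow> x \<otimes> a \<in> K U'"
      using Q'.coset_eq_iff[OF xaP[OF xR] z] proj_minus[OF f(1) xaP[OF xR] z] xR aR
      by (simp add: a_minus_def)
    finally show ?thesis .
  qed
  have "a \<notin> J"
  proof
    assume "a \<in> J"
    have "?\<pi>' f \<in> \<phi> ` carrier (quot_module P (K U))"
      using \<phi>s(2) ps'(1)[OF fP] unfolding bij_betw_def by simp
    then obtain X where X: "X \<in> carrier (quot_module P (K U))" "?\<pi>' f = \<phi> X" by blast
    then obtain c where c: "c \<in> carrier P" "X = ?\<pi> c" using ps(2) by meson
    have cR: "c \<in> carrier R" using c P_iff by simp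
    have "?\<pi>' f = ?\<pi>' (c \<otimes> a)" using X c key by simp
    then have d: "f \<ominus> c \<otimes> a \<in> K U'"
      using Q'.coset_eq_iff[OF fP xaP[OF cR]] proj_minus[OF f(1) fP xaP[OF cR]] by simp
    have "v \<in> U'" if v: "v \<in> carrier V" for v
    proof -
      have vN: "v \<in> N" "g \<otimes> v = v" "v \<otimes> f = v" "v \<in> carrier R" using v V_iff N.Icarr by blast+
      have "v \<otimes> (c \<otimes> a) = \<zero>" by (rule NJ[OF vN(1) J.I_l_closed[OF \<open>a \<in> J\<close> cR]])
      then have "v \<otimes> (f \<ominus> c \<otimes> a) = v" using vN f cR aR by (simp add: a_minus_def r_distr r_minus)
      then have "v \<in> K U'" using submodule.smult_closed[OF K_submodule[OF U'(1)] vN(4) d] by simp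
      then show ?thesis using K_eq[OF U'(1)] vN by simp
    qed
    then show False using U' unfolding subspace_def by blast
  qed
  then have unit: "a \<in> Units (corner R f)"
    by (rule primitive_corner_unit[OF pi_regular primitive[OF i] a])
  then obtain a' where a': "a' \<in> carrier (corner R f)" "a' \<otimes> a = f" by (auto simp: Units_def)
  have a'R: "a' \<in> carrier R" "a' \<otimes> f = a'" using a' corner_carrier_iff[OF f] by simp_all
  have UV: "u \<in> N" "g \<otimes> u = u" "u \<otimes> f = u" "u \<in> carrier R" if "u \<in> U \<or> u \<in> U'" for u
    using U U' that V_iff N.Icarr unfolding subspace_def by blast+
  have "(\<lambda>u. u \<otimes> a) ` U = U'"
  proof
    show "(\<lambda>u. u \<otimes> a) ` U \<subseteq> U'"
    proof
      fix v assume "v \<in> (\<lambda>u. u \<otimes> a) ` U"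
      then obtain u where u: "u \<in> U" "v = u \<otimes> a" by blast
      then have "u \<in> K U" using UV K_eq[OF U] by simp
      then have "g \<otimes> (u \<otimes> a) \<in> U'" using kernel UV u P_iff K_eq[OF U'(1)] by simp
      moreover have "g \<otimes> (u \<otimes> a) = u \<otimes> a" using UV[of u] u g aR by (simp add: m_assoc[symmetric])
      ultimately show "v \<in> U'" using u by simp
    qed
    show "U' \<subseteq> (\<lambda>u. u \<otimes> a) ` U"
    proof
      fix v assume v: "v \<in> U'"
      note vV = UV[OF disjI2[OF v]]
      let ?u = "v \<otimes> a'"
      have ua: "?u \<otimes> a = v" using vV a' a'R aR by (simp add: m_assoc)
      have "?u \<in> carrier P" using vV a'R f P_iff by (simp add: m_assoc)
      moreover have "v \<in> K U'" using vV v K_eq[OF U'(1)] by simp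
      ultimately have "?u \<in> K U" using kernel ua by simp
      then have "g \<otimes> ?u \<in> U" using K_eq[OF U] by simp
      moreover have "g \<otimes> ?u = ?u" using vV g a'R by (simp add: m_assoc[symmetric])
      ultimately show "v \<in> (\<lambda>u. u \<otimes> a) ` U" using ua by force
    qed
  qed
  with unit show thesis by (rule that)
qed

lemma translate_imp_iso:
  assumes U: "subspace U" and U': "subspace U'"
    and a: "a \<in> Units (corner R f)" and Ua: "(\<lambda>u. u \<otimes> a) ` U = U'"
  shows "module_isomorphic R (quot_module P (K U)) (quot_module P (K U'))"
proof -
  interpret Q: quotient_module R P "K U" by (rule K_quotient[OF U])
  interpret Q': quotient_module R P "K U'" by (rule K_quotient[OF U'])
  have P: "left_module R P" by (rule left_module_proj[OF f(1)])
  obtain a' where a': "a' \<in> carrier (corner R f)" "a' \<otimes> a = f" "a \<otimes> a' = f"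
    using a by (auto simp: Units_def)
  have a'R: "a' \<in> carrier R" "a' \<otimes> f = a'" using a' corner_carrier_iff[OF f] by simp_all
  have aR: "a \<in> carrier R" "a \<otimes> f = a" using a corner_carrier_iff[OF f] by (simp_all add: Units_def)
  have mult: "(\<lambda>x. x \<otimes> a) \<in> module_epi R P P"
  proof (rule module_epiI)
    fix z assume z: "z \<in> carrier P"
    then have "(z \<otimes> a') \<otimes> a = z" "z \<otimes> a' \<in> carrier P" using P_iff a' a'R aR f by (simp_all add: m_assoc)
    then show "\<exists>x\<in>carrier P. x \<otimes> a = z" by blast
  qed (use aR f in \<open>auto simp: P_iff m_assoc l_distr\<close>)
  have epi: "(\<lambda>x. K U' +>\<^bsub>P\<^esub> x) \<circ> (\<lambda>x. x \<otimes> a) \<in> module_epi R P (quot_module P (K U'))"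
    by (rule module_epi_comp[OF mult Q'.coset_map_epi])
  have kernel: "x \<in> K U \<longleftrightarrow> x \<otimes> a \<in> K U'" if "x \<in> carrier P" for x
  proof -
    have x: "x \<in> carrier R" "x \<otimes> f = x" using that P_iff by simp_all
    have cancel: "y \<otimes> a \<otimes> a' = y" if "y \<in> carrier R" "y \<otimes> f = y" for y
      using that a' a'R aR by (simp add: m_assoc)
    have "x \<in> N \<longleftrightarrow> x \<otimes> a \<in> N"
      using N.I_r_closed[of x a] N.I_r_closed[of "x \<otimes> a" a'] aR a'R cancel[OF x] by auto
    moreover have "g \<otimes> x \<in> U \<longleftrightarrow> g \<otimes> (x \<otimes> a) \<in> U'"
    proof
      assume "g \<otimes> x \<in> U"
      then have "(g \<otimes> x) \<otimes> a \<in> U'" using Ua by blast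
      then show "g \<otimes> (x \<otimes> a) \<in> U'" using x g aR by (simp add: m_assoc)
    next
      assume "g \<otimes> (x \<otimes> a) \<in> U'"
      then obtain u where u: "u \<in> U" "g \<otimes> (x \<otimes> a) = u \<otimes> a" using Ua by blast
      have "u \<in> carrier R" "u \<otimes> f = u" using U u V_iff N.Icarr unfolding subspace_def by blast+
      then have "u = (g \<otimes> x) \<otimes> a \<otimes> a'" using cancel[of u] u x g aR by (simp add: m_assoc)
      also have "\<dots> = g \<otimes> x" using x g f by (intro cancel) (simp_all add: m_assoc)
      finally show "g \<otimes> x \<in> U" using u by simp
    qed
    ultimately show ?thesis using x aR f K_eq[OF U] K_eq[OF U'] by (simp add: m_assoc)
  qed
  have "K U +>\<^bsub>P\<^esub> x = K U +>\<^bsub>P\<^esub> y \<longleftrightarrow>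
      ((\<lambda>x. K U' +>\<^bsub>P\<^esub> x) \<circ> (\<lambda>x. x \<otimes> a)) x = ((\<lambda>x. K U' +>\<^bsub>P\<^esub> x) \<circ> (\<lambda>x. x \<otimes> a)) y"
    if xy: "x \<in> carrier P" "y \<in> carrier P" for x y
  proof -
    have m: "x \<ominus>\<^bsub>P\<^esub> y \<in> carrier P" using xy by (rule Q.M.minus_closed)
    have "(x \<ominus>\<^bsub>P\<^esub> y) \<otimes> a = (x \<otimes> a) \<ominus>\<^bsub>P\<^esub> (y \<otimes> a)" by (rule module_epi_minus[OF P P mult xy])
    then show ?thesis
      using Q.coset_eq_iff[OF xy] Q'.coset_eq_iff module_epiD(1)[OF mult] xy kernel[OF m] by simp
  qed
  then obtain \<phi> where "\<phi> \<in> module_iso R (quot_module P (K U)) (quot_module P (K U'))"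
    by (rule induced_module_iso[OF P Q.coset_map_epi epi])
  then show ?thesis unfolding module_isomorphic_def by (rule ex_in_conv[THEN iffD1, OF exI])
qed

lemma corner_ideal:
  assumes h: "h \<in> {1..t}"
  shows "ideal {e h \<otimes> x \<otimes> e h | x. x \<in> J} (corner R (e h))"
    and "{e h \<otimes> x \<otimes> e h | x. x \<in> J} \<subseteq> J"
proof -
  note eh = e_idem[OF h]
  interpret C: ring "corner R (e h)" by (rule corner_ring[OF eh])
  have I: "{e h \<otimes> x \<otimes> e h | x. x \<in> J} = J \<inter> carrier (corner R (e h))" (is "?I = _")
  proof -
    have "x \<in> ?I" if "x \<in> J" "x \<in> carrier (corner R (e h))" for x
      using that corner_carrier_iff[OF eh] by (auto intro!: exI[of _ x])
    then show ?thesis using eh J.Icarr by (auto simp: corner_sel(1) intro: J.I_l_closed J.I_r_closed)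
  qed
  then show "?I \<subseteq> J" by blast
  have neg: "inv\<^bsub>add_monoid (corner R (e h))\<^esub> x = \<ominus> x" if "x \<in> carrier (corner R (e h))" for x
  proof -
    have "\<ominus>\<^bsub>corner R (e h)\<^esub> x = \<ominus> x"
      by (rule C.minus_equality) (use that eh in \<open>simp_all add: corner_carrier_iff[OF eh] l_neg l_minus r_minus\<close>)
    then show ?thesis by (simp add: a_inv_def)
  qed
  show "ideal ?I (corner R (e h))"
    unfolding I
  proof (rule idealI)
    show "subgroup (J \<inter> carrier (corner R (e h))) (add_monoid (corner R (e h)))"
    proof (rule subgroup.intro)
      fix x assume x: "x \<in> J \<inter> carrier (corner R (e h))"
      then have "inv\<^bsub>add_monoid (corner R (e h))\<^esub> x \<in> carrier (corner R (e h))"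
        using C.a_inv_closed[of x] unfolding a_inv_def by blast
      moreover have "inv\<^bsub>add_monoid (corner R (e h))\<^esub> x \<in> J"
        using x neg[of x] J.a_inv_closed[of x] by (metis IntD1 IntD2)
      ultimately show "inv\<^bsub>add_monoid (corner R (e h))\<^esub> x \<in> J \<inter> carrier (corner R (e h))" by blast
    qed (use C.a_closed C.zero_closed in \<open>auto\<close>)
  qed (use C.m_closed C.ring_axioms J.I_l_closed J.I_r_closed corner_carrier_iff[OF eh] in \<open>auto\<close>)
qed

text \<open>Any representative computes the action since \<open>J N = N J = 0\<close>; the zero element of the ideal
  guarantees that there is one.\<close>

lemma act_coset:
  assumes h: "h \<in> {1..t}" and v: "v \<in> N" and a: "a \<in> carrier R"
  defines "c \<equiv> {e h \<otimes> x \<otimes> e h | x. x \<in> J} +> a"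
  shows "left_act R c v = a \<otimes> v" "right_act R v c = v \<otimes> a"
proof -
  let ?I = "{e h \<otimes> x \<otimes> e h | x. x \<in> J}"
  have IJ: "?I \<subseteq> J" by (rule corner_ideal(2)[OF h])
  have "\<zero> = e h \<otimes> \<zero> \<otimes> e h" using e_idem(1)[OF h] by simp
  then have "\<zero> \<in> ?I" using J.zero_closed by blast
  moreover have "a \<in> {\<zero> \<oplus> a}" using a by simp
  ultimately have ne: "a \<in> c" unfolding c_def a_r_coset_def' by (rule UN_I)
  have c: "x \<otimes> v = a \<otimes> v \<and> v \<otimes> x = v \<otimes> a" if x: "x \<in> c" for x
  proof -
    obtain y where y: "y \<in> ?I" "x = y \<oplus> a"
      using x unfolding c_def a_r_coset_def' by (elim UN_E singletonE)
    with IJ have "y \<in> J" by (elim subsetD)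
    with y(2) show ?thesis using JN NJ v a N.Icarr J.Icarr by (simp add: l_distr r_distr)
  qed
  have "(\<lambda>x. x \<otimes> v) ` c = (\<lambda>x. a \<otimes> v) ` c" by (rule image_cong[OF refl]) (rule c[THEN conjunct1])
  moreover have "(\<lambda>x. v \<otimes> x) ` c = (\<lambda>x. v \<otimes> a) ` c" by (rule image_cong[OF refl]) (rule c[THEN conjunct2])
  ultimately have "(\<lambda>x. x \<otimes> v) ` c = {a \<otimes> v}" "(\<lambda>x. v \<otimes> x) ` c = {v \<otimes> a}"
    by (simp_all only: image_constant[OF ne])
  then show "left_act R c v = a \<otimes> v" "right_act R v c = v \<otimes> a"
    by (simp_all add: left_act_def right_act_def)
qed

lemma top_div_carrier:
  "carrier (top_div R (e h)) = {{e h \<otimes> x \<otimes> e h | x. x \<in> J} +> a | a. a \<in> carrier (corner R (e h))}"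
  "\<one>\<^bsub>top_div R (e h)\<^esub> = {e h \<otimes> x \<otimes> e h | x. x \<in> J} +> e h"
  "\<zero>\<^bsub>top_div R (e h)\<^esub> = {e h \<otimes> x \<otimes> e h | x. x \<in> J}"
  by (auto simp: top_div_def FactRing_def A_RCOSETS_def')

text \<open>Units lift modulo the radical: if \<open>b a\<close> is congruent to \<open>f\<close>, then \<open>a\<close> is outside
  the radical because \<open>f\<close> is, and the corner is local.\<close>

lemma Units_top_div:
  "Units (top_div R f) = {I +> a | a. a \<in> Units (corner R f)}"
proof -
  interpret C: ideal I "corner R f" by (rule corner_ideal(1)[OF i])
  have IJ: "I \<subseteq> J" by (rule corner_ideal(2)[OF i])
  have hom: "(+>) I \<in> ring_hom (corner R f) (top_div R f)"
    using C.rcos_ring_hom by (simp add: top_div_def)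
  show ?thesis
  proof (intro equalityI subsetI)
    fix d assume "d \<in> Units (top_div R f)"
    then obtain d' where d: "d \<in> carrier (top_div R f)" "d' \<in> carrier (top_div R f)"
      "d' \<otimes>\<^bsub>top_div R f\<^esub> d = \<one>\<^bsub>top_div R f\<^esub>" unfolding Units_def by blast
    then obtain a b where a: "a \<in> carrier (corner R f)" "d = I +> a"
      and b: "b \<in> carrier (corner R f)" "d' = I +> b" unfolding top_div_carrier by blast
    have "I +> (b \<otimes> a) = I +> f"
      using d(3) ring_hom_mult[OF hom b(1) a(1)] a b by (simp add: top_div_carrier)
    moreover have "f \<in> I +> f"
      using C.a_rcos_self[of f] C.one_closed by simp
    ultimately have "f \<in> I +> (b \<otimes> a)" by simp
    then obtain x where x': "x \<in> I" "f = x \<oplus> b \<otimes> a"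
      unfolding a_r_coset_def' by (elim UN_E singletonE)
    with IJ have x: "x \<in> J" "f = x \<oplus> b \<otimes> a" by (auto elim: subsetD simp del: mem_Collect_eq)
    have "a \<notin> J"
    proof
      assume "a \<in> J"
      then have "x \<oplus> b \<otimes> a \<in> J" using x b corner_carrier_iff[OF f] by (simp add: J.I_l_closed)
      then show False using x e_not_J[OF i] by simp
    qed
    then show "d \<in> {I +> a | a. a \<in> Units (corner R f)}"
      using primitive_corner_unit[OF pi_regular primitive[OF i] a(1)] a(2) by blast
  next
    fix d assume "d \<in> {I +> a | a. a \<in> Units (corner R f)}"
    then obtain a b where ab: "d = I +> a" "a \<in> carrier (corner R f)" "b \<in> carrier (corner R f)"
      "b \<otimes> a = f" "a \<otimes> b = f" by (auto simp: Units_def)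
    then have "(I +> b) \<otimes>\<^bsub>top_div R f\<^esub> d = \<one>\<^bsub>top_div R f\<^esub>" "d \<otimes>\<^bsub>top_div R f\<^esub> (I +> b) = \<one>\<^bsub>top_div R f\<^esub>"
      using ring_hom_mult[OF hom, of a b] ring_hom_mult[OF hom, of b a] by (simp_all add: top_div_carrier)
    moreover have "I +> b \<in> carrier (top_div R f)" "d \<in> carrier (top_div R f)"
      using ab unfolding top_div_carrier by blast+
    ultimately show "d \<in> Units (top_div R f)" unfolding Units_def by blast
  qed
qed

text \<open>Positive codimension is what excludes \<open>U = V\<close>, where the quotient would have dimension zero.\<close>

lemma Gr_subspace:
  assumes U: "U \<in> Gr_codim (top_div R g) V s" and s: "1 \<le> s"
  shows "subspace U" "U \<noteq> carrier V"
proof -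
  interpret U: submodule U "top_div R g" V using U by (simp add: Gr_codim_def)
  have UV: "U \<subseteq> carrier V" using U.subset by simp
  have mult: "g \<otimes> (r \<otimes> u) \<in> U" if r: "r \<in> carrier R" and u: "u \<in> U" for r u
  proof -
    have uN: "u \<in> N" "g \<otimes> u = u" "u \<in> carrier R" using u UV V_iff N.Icarr by blast+
    let ?a = "g \<otimes> r \<otimes> g"
    have "?a \<in> carrier (corner R g)" using r unfolding corner_sel(1) by blast
    then have "{g \<otimes> x \<otimes> g | x. x \<in> J} +> ?a \<in> carrier (top_div R g)" unfolding top_div_carrier by blast
    then have "left_act R ({g \<otimes> x \<otimes> g | x. x \<in> J} +> ?a) u \<in> U" using U.smult_closed u by simp
    then have "?a \<otimes> u \<in> U" using act_coset(1)[OF j uN(1), of ?a] r g by simp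
    then show ?thesis using r g uN by (simp add: m_assoc)
  qed
  show sub: "subspace U"
    unfolding subspace_def using UV U.one_closed U.m_closed mult by auto
  show "U \<noteq> carrier V"
  proof
    assume UV': "U = carrier V"
    have neg: "\<ominus> v \<in> carrier V" if "v \<in> carrier V" for v using subspace_minus[OF sub] UV' that by simp
    have V: "abelian_group V"
    proof (rule abelian_groupI)
      fix x assume x: "x \<in> carrier V"
      then have "\<ominus> x \<oplus> x = \<zero>" using V_iff N.Icarr l_neg by blast
      then show "\<exists>y\<in>carrier V. y \<oplus>\<^bsub>V\<^esub> x = \<zero>\<^bsub>V\<^esub>" using neg[OF x] by (auto)
    qed (use sub UV' V_iff N.Icarr in \<open>auto simp: subspace_def a_ac\<close>)
    interpret V: abelian_group V by (rule V)
    interpret UU: abelian_subgroup U V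
      by (rule abelian_subgroupI3)
        (use U.subgroup_axioms V in \<open>simp_all add: additive_subgroup_def\<close>)
    have coset: "U +>\<^bsub>V\<^esub> v = U" if "v \<in> U" for v
      using UU.a_rcos_const that by blast
    have triv: "carrier (quot_module V U) = {\<zero>\<^bsub>quot_module V U\<^esub>}"
      using UV' coset UU.zero_closed by (auto simp: A_RCOSETS_def')
    let ?D = "top_div R g"
    have "vdim ?D (quot_module V U) = 0"
    proof (rule vdim_trivial[OF quot_module_add_group[OF UU.abelian_subgroup_axioms] triv])
      have gC: "g \<in> carrier (corner R g)" using g corner_carrier_iff[OF g] by simp
      then show "\<one>\<^bsub>?D\<^esub> \<in> carrier ?D" unfolding top_div_carrier by blast
      interpret C: ideal "{g \<otimes> x \<otimes> g | x. x \<in> J}" "corner R g" by (rule corner_ideal(1)[OF j])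
      show "\<one>\<^bsub>?D\<^esub> \<noteq> \<zero>\<^bsub>?D\<^esub>"
        using C.a_rcos_self[OF gC] corner_ideal(2)[OF j] e_not_J[OF j] unfolding top_div_carrier by auto
      have "left_act R \<one>\<^bsub>?D\<^esub> u = u" if "u \<in> U" for u
        using act_coset(1)[OF j, of u g] that UV V_iff g unfolding top_div_carrier by auto
      then show "\<one>\<^bsub>?D\<^esub> \<odot>\<^bsub>quot_module V U\<^esub> \<zero>\<^bsub>quot_module V U\<^esub> = \<zero>\<^bsub>quot_module V U\<^esub>"
        using coset UU.zero_closed by auto
    qed
    then show False using U s by (simp add: Gr_codim_def)
  qed
qed

lemma right_transitive_iff:
  assumes G: "\<And>U. U \<in> G \<Longrightarrow> subspace U"
  shows "right_transitive R f G \<longleftrightarrow>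
    (\<forall>U\<in>G. \<forall>U'\<in>G. \<exists>a\<in>Units (corner R f). (\<lambda>u. u \<otimes> a) ` U = U')"
proof -
  have act: "(\<lambda>v. right_act R v (I +> a)) ` U = (\<lambda>u. u \<otimes> a) ` U"
    if U: "U \<in> G" and a: "a \<in> Units (corner R f)" for U a
  proof (rule image_cong[OF refl])
    fix v assume "v \<in> U"
    then have "v \<in> N" using G[OF U] V_iff unfolding subspace_def by blast
    moreover have "a \<in> carrier R" using a corner_carrier_iff[OF f] by (simp add: Units_def)
    ultimately show "right_act R v (I +> a) = v \<otimes> a" by (rule act_coset(2)[OF i])
  qed
  have bex_image: "(\<exists>d\<in>{h a | a. a \<in> A}. Q d) \<longleftrightarrow> (\<exists>a\<in>A. Q (h a))"
    for h :: "'a \<Rightarrow> 'a set" and A Q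
    by blast
  have "(\<exists>d\<in>Units (top_div R f). (\<lambda>v. right_act R v d) ` U = U') \<longleftrightarrow>
      (\<exists>a\<in>Units (corner R f). (\<lambda>u. u \<otimes> a) ` U = U')" if U: "U \<in> G" for U U'
  proof -
    have "(\<exists>d\<in>Units (top_div R f). (\<lambda>v. right_act R v d) ` U = U') \<longleftrightarrow>
        (\<exists>a\<in>Units (corner R f). (\<lambda>v. right_act R v (I +> a)) ` U = U')"
      unfolding Units_top_div by (rule bex_image)
    then show ?thesis by (simp add: act[OF U] cong: bex_cong)
  qed
  then show ?thesis unfolding right_transitive_def by (simp cong: ball_cong)
qed

lemma same_proper_tower_K:
  assumes "subspace U" "subspace U'"
  shows "same_proper_tower R n (quot_module P (K U)) (quot_module P (K U'))"
  by (rule same_tower_of_deep_submodules[OF f K_submodule[OF assms(1)] _ K_submodule[OF assms(2)]])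
    (use K_eq assms in auto)

end

section \<open>Uniqueness and transitivity\<close>

theorem mainTheorem2:
  fixes k :: "'k ring" and \<Lambda> :: "('k, 'a) module"
    and e :: "nat \<Rightarrow> 'a" and n t i j s :: nat
  assumes algebra: "fin_dim_algebra k \<Lambda>"
    and n: "n \<ge> 1"
    and nilpotent: "rad_pow \<Lambda> n = {\<zero>\<^bsub>\<Lambda>\<^esub>}"
    and idempotents: "complete_primitive_orthogonal \<Lambda> t e"
    and basic: "basic_wrt \<Lambda> t e"
    and i: "i \<in> {1..t}" and j: "j \<in> {1..t}"
    and V_nonzero: "carrier (V_space \<Lambda> n (e i) (e j)) \<noteq> {\<zero>\<^bsub>\<Lambda>\<^esub>}"
    and s: "1 \<le> s" "s \<le> vdim (top_div \<Lambda> (e j)) (V_space \<Lambda> n (e i) (e j))"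
  defines "G \<equiv> Gr_codim (top_div \<Lambda> (e j)) (V_space \<Lambda> n (e i) (e j)) s"
    and "M \<equiv> terminal_completion \<Lambda> n t e i j"
  shows "((\<forall>U\<in>G. \<forall>U'\<in>G. module_isomorphic \<Lambda> (M U) (M U')) \<longleftrightarrow> right_transitive \<Lambda> (e i) G) \<and>
         (\<not> right_transitive \<Lambda> (e i) G \<longleftrightarrow>
            (\<exists>U\<in>G. \<exists>U'\<in>G. \<not> module_isomorphic \<Lambda> (M U) (M U') \<and>
               same_proper_tower \<Lambda> n (M U) (M U')))"
proof -
  interpret ring \<Lambda> using algebra by (simp add: fin_dim_algebra_def)
  interpret nilpotent_basic_algebra \<Lambda> n t i j e
    by unfold_locales
      (fact fin_dim_algebra_strongly_pi_regular[OF algebra] n nilpotent idempotents basic i j)+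
  have G: "subspace U" "U \<noteq> carrier V" if "U \<in> G" for U
    using Gr_subspace[OF _ s(1)] that unfolding G_def by blast+
  have M: "M U = quot_module P (K U)" for U by (simp add: M_def terminal_completion_def)
  have iso: "module_isomorphic \<Lambda> (M U) (M U') \<longleftrightarrow>
      (\<exists>a\<in>Units (corner \<Lambda> (e i)). (\<lambda>u. u \<otimes>\<^bsub>\<Lambda>\<^esub> a) ` U = U')" if U: "U \<in> G" "U' \<in> G" for U U'
  proof
    assume "module_isomorphic \<Lambda> (M U) (M U')"
    then obtain \<phi> where "\<phi> \<in> module_iso \<Lambda> (quot_module P (K U)) (quot_module P (K U'))"
      unfolding M module_isomorphic_def by blast
    from iso_imp_translate[OF G(1)[OF U(1)] G[OF U(2)] this]
    show "\<exists>a\<in>Units (corner \<Lambda> (e i)). (\<lambda>u. u \<otimes>\<^bsub>\<Lambda>\<^esub> a) ` U = U'" by metis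
  next
    assume "\<exists>a\<in>Units (corner \<Lambda> (e i)). (\<lambda>u. u \<otimes>\<^bsub>\<Lambda>\<^esub> a) ` U = U'"
    then show "module_isomorphic \<Lambda> (M U) (M U')"
      unfolding M using translate_imp_iso[OF G(1)[OF U(1)] G(1)[OF U(2)]] by blast
  qed
  have trans: "right_transitive \<Lambda> (e i) G \<longleftrightarrow> (\<forall>U\<in>G. \<forall>U'\<in>G. module_isomorphic \<Lambda> (M U) (M U'))"
    using right_transitive_iff[of G] G(1) iso by simp
  moreover have "same_proper_tower \<Lambda> n (M U) (M U')" if "U \<in> G" "U' \<in> G" for U U'
    unfolding M by (rule same_proper_tower_K[OF G(1)[OF that(1)] G(1)[OF that(2)]])
  ultimately show ?thesis by blast
qed

end
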